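(* Suppose the probability space $(\Omega,\mathcal{A},\mathbf{P})$ is complete. Let $S_2:\mathbb{R}\to\mathbb{R}$ and $r>0$. Then $S_2$ is the specific covariogram of a stationary random closed set $Z\subset\mathbb{R}$ such that $\mathbf{E}\,\mathcal{H}^0(\partial Z\cap(0,1))\le r$ if and only if $S_2$ is $\mathcal{F}$-specific covariogram admissible and Lipschitz with Lipschitz constant $L\le r/2$.
   Context: A random closed set (RACS) is a map $Z:\Omega\to\mathcal{F}$ (closed subsets of $\mathbb{R}$) with $\{Z\cap K\ne\emptyset\}\in\mathcal{A}$ for every compact $K$; it is stationary if its law is translation invariant. Its specific covariogram is $y\mapsto\mathbf{E}\,\mathcal{L}^1(Z\cap(y+Z)\cap(0,1))$. $\mathcal{H}^0$ is counting measure and $\partial Z$ the topological boundary. Let $\mathcal{W}$ be the bounded open $W\subset\mathbb{R}$ with $\mathcal{L}^1(\partial W)=0$ and $\delta_{y;W}(F)=\mathcal{L}^1(F\cap(y+F)\cap W)$. $S_2$ is $\mathcal{F}$-specific covariogram admissible if for all $q\ge1$, $a\in\mathbb{R}^q$, $y_i\in\mathbb{R}$, $W_i\in\mathcal{W}$, $c\in\mathbb{R}$: $[c+\sum_ia_i\delta_{y_i;W_i}(F)\ge0$ for all closed $F\subset\mathbb{R}]\Rightarrow c+\sum_ia_iS_2(y_i)\mathcal{L}^1(W_i)\ge0$. *)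

theory Defs
  imports "HOL-Probability.Probability"
begin

text \<open>Effros sigma-algebra on subsets of the real line: generated by the hitting
  events {F. F \<inter> K \<noteq> {}} for compact K. (Random closed sets only take closed values.)\<close>
definition effros :: "real set measure" where
  "effros = sigma UNIV {{F. F \<inter> K \<noteq> {}} | K. compact K}"

definition racs :: "'w measure \<Rightarrow> ('w \<Rightarrow> real set) \<Rightarrow> bool" where
  "racs M Z \<longleftrightarrow> (\<forall>\<omega>\<in>space M. closed (Z \<omega>)) \<and>
     (\<forall>K. compact K \<longrightarrow> {\<omega>\<in>space M. Z \<omega> \<inter> K \<noteq> {}} \<in> sets M)"

definition stationary_racs :: "'w measure \<Rightarrow> ('w \<Rightarrow> real set) \<Rightarrow> bool" where
  "stationary_racs M Z \<longleftrightarrow> racs M Z \<and>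
     (\<forall>y::real. distr M effros (\<lambda>\<omega>. (\<lambda>x. y + x) ` Z \<omega>) = distr M effros Z)"

definition specific_covariogram :: "'w measure \<Rightarrow> ('w \<Rightarrow> real set) \<Rightarrow> real \<Rightarrow> real" where
  "specific_covariogram M Z y =
     (\<integral>\<omega>. measure lborel (Z \<omega> \<inter> ((\<lambda>x. y + x) ` Z \<omega>) \<inter> {0<..<1}) \<partial>M)"

definition expected_boundary_count :: "'w measure \<Rightarrow> ('w \<Rightarrow> real set) \<Rightarrow> ennreal" where
  "expected_boundary_count M Z =
     (\<integral>\<^sup>+\<omega>. emeasure (count_space UNIV) (frontier (Z \<omega>) \<inter> {0<..<1}) \<partial>M)"

definition windows :: "real set set" where
  "windows = {W. bounded W \<and> open W \<and> measure lborel (frontier W) = 0}"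

definition delta_yW :: "real \<Rightarrow> real set \<Rightarrow> real set \<Rightarrow> real" where
  "delta_yW y W F = measure lborel (F \<inter> ((\<lambda>x. y + x) ` F) \<inter> W)"

definition F_spec_cov_admissible :: "(real \<Rightarrow> real) \<Rightarrow> bool" where
  "F_spec_cov_admissible S2 \<longleftrightarrow>
     (\<forall>(q::nat) (a::nat \<Rightarrow> real) (y::nat \<Rightarrow> real) (W::nat \<Rightarrow> real set) (c::real).
        q \<ge> 1 \<longrightarrow> (\<forall>i<q. W i \<in> windows) \<longrightarrow>
        (\<forall>F::real set. closed F \<longrightarrow> c + (\<Sum>i<q. a i * delta_yW (y i) (W i) F) \<ge> 0) \<longrightarrow>
        c + (\<Sum>i<q. a i * S2 (y i) * measure lborel (W i)) \<ge> 0)"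

end

theory Submission
  imports Defs "HOL-Complex_Analysis.Great_Picard"
begin

text \<open>Necessity: by stationarity and Fubini, the specific covariogram at \<open>y\<close> is the probability that
  \<open>0\<close> and \<open>- y\<close> both lie in \<open>Z\<close>, so the expectation of every admissible functional is the required one.
  A change of membership between consecutive grid points forces a boundary point in between, so the
  probability that exactly one of \<open>0\<close> and \<open>h\<close> lies in \<open>Z\<close> is at most \<open>r \<bar>h\<bar>\<close>, and half of it bounds
  the increments of the covariogram.

  Sufficiency: by admissibility no linear functional separates \<open>S2\<close> from the covariograms of closed
  sets, so a greedy choice of closed sets makes their average covariograms on longer and
  longer windows converge to \<open>S2\<close>. A limit of the laws of their uniformly shifted traces on the
  rationals is a law on sets of rationals, invariant under rational shifts, with exact two-point
  function \<open>S2\<close>. The closure of this random set of rationals realizes \<open>S2\<close>: the Lipschitz bound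
  controls the expected number of changes of membership along finer and finer grids, hence by
  Fatou's lemma the number of boundary points, and it also shows that almost surely the closure
  adds no given rational point.\<close>

subsection \<open>Averaging closed sets\<close>

text \<open>Membership of a point is not continuous under the usual convergence of closed sets: ever
  finer finite grids converge to the whole line. A limit taken there could gain points and change
  the two-point function. Probabilities of finite traces on a countable set, in contrast, pass to
  the limit exactly; closedness is lost on the way and has to be restored. The Lipschitz bound makes
  this harmless, since it bounds the expected number of changes on an interval by \<open>r\<close>
  times its length, whatever the grid. The factor \<open>1/2\<close> reflects stationarity: entering
  and leaving the set between two points at distance \<open>h\<close> are equally likely, so a
  change has probability \<open>2 * (S2 0 - S2 h)\<close>. The approximations may be crude: sums
  over windows of length \<open>n\<close> match up to \<open>1\<close> and a shift by
  \<open>d\<close> costs \<open>\<bar>d\<bar>\<close>; both errors vanish after division by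
  \<open>n\<close>. The greedy choice replaces a separation theorem; as an infimum over closed sets
  need not be attained, inner products up to \<open>1\<close> rather than \<open>0\<close> are
  allowed.\<close>

text \<open>Each chosen vector has inner product at most \<open>1\<close> with the running sum, so the squared norm of the
  sum grows only linearly.\<close>

lemma greedy_average:
  fixes v :: "'a \<Rightarrow> nat \<Rightarrow> real" and \<epsilon> :: real
  assumes bound: "\<And>x i. x \<in> X \<Longrightarrow> i < q \<Longrightarrow> \<bar>v x i\<bar> \<le> B"
    and below: "\<And>a. \<exists>x\<in>X. (\<Sum>i<q. a i * v x i) \<le> 1"
    and "\<epsilon> > 0"
  obtains T :: nat and x :: "nat \<Rightarrow> 'a"
  where "T \<ge> 1" "\<And>k. x k \<in> X" "\<And>i. i < q \<Longrightarrow> \<bar>\<Sum>k<T. v (x k) i\<bar> \<le> \<epsilon> * T"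
proof -
  obtain f where f: "\<And>a. f a \<in> X" "\<And>a. (\<Sum>i<q. a i * v (f a) i) \<le> 1"
    using below by metis
  define U where "U = rec_nat (\<lambda>i. 0) (\<lambda>k u i. u i + v (f u) i)"
  define x where "x k = f (U k)" for k
  have U0: "U 0 = (\<lambda>i. 0)" and US: "U (Suc k) = (\<lambda>i. U k i + v (x k) i)" for k
    by (simp_all add: U_def x_def)
  have U_sum: "U k i = (\<Sum>j<k. v (x j) i)" for k i
    by (induction k) (simp_all add: U0 US)
  \<comment> \<open>The \<open>2\<close> is twice the permitted inner product with the running sum,
    and \<open>q * B\<^sup>2\<close> bounds the squared norm of the new vector. Since
    \<open>T * C\<close> is below the square of \<open>\<epsilon> * T\<close> once \<open>T\<close>
    exceeds \<open>C / \<epsilon>\<^sup>2\<close>, that is how \<open>T\<close> is chosen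
    later.\<close>
  define C where "C = 2 + real q * B\<^sup>2"
  have norm: "(\<Sum>i<q. (U k i)\<^sup>2) \<le> k * C" for k
  proof (induction k)
    case (Suc k)
    have "(v (x k) i)\<^sup>2 \<le> B\<^sup>2" if "i < q" for i
      using bound[of "x k" i] f(1) that by (auto simp: x_def simp flip: abs_le_square_iff)
    then have "(\<Sum>i<q. (v (x k) i)\<^sup>2) \<le> (\<Sum>i<q. B\<^sup>2)"
      by (intro sum_mono) simp
    then have "(\<Sum>i<q. (v (x k) i)\<^sup>2) \<le> q * B\<^sup>2" by simp
    moreover have "(\<Sum>i<q. U k i * v (x k) i) \<le> 1"
      using f(2)[of "U k"] by (simp add: x_def)
    moreover have "(\<Sum>i<q. (U (Suc k) i)\<^sup>2) = (\<Sum>i<q. (U k i)\<^sup>2) + 2 * (\<Sum>i<q. U k i * v (x k) i) + (\<Sum>i<q. (v (x k) i)\<^sup>2)"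
      by (simp add: US power2_sum sum.distrib sum_distrib_left mult.assoc)
    ultimately show ?case using Suc by (simp add: C_def algebra_simps)
  qed (simp add: U0)
  obtain T :: nat where T: "real T > C / \<epsilon>\<^sup>2" using reals_Archimedean2 by blast
  have "C > 0" by (simp add: C_def add_pos_nonneg)
  then have "C / \<epsilon>\<^sup>2 > 0" using \<open>\<epsilon> > 0\<close> by simp
  then have T1: "T \<ge> 1" using T by (cases T) auto
  show thesis
  proof (rule that[OF T1])
    show "x k \<in> X" for k by (simp add: x_def f)
    fix i assume i: "i < q"
    have "(U T i)\<^sup>2 \<le> (\<Sum>i<q. (U T i)\<^sup>2)"
      using i by (intro member_le_sum) auto
    also have "\<dots> \<le> T * C" by (rule norm)
    also have "\<dots> \<le> T * (\<epsilon>\<^sup>2 * T)"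
      using T \<open>\<epsilon> > 0\<close> by (intro mult_left_mono) (auto simp: field_simps)
    also have "\<dots> = (\<epsilon> * T)\<^sup>2" by (simp add: power2_eq_square)
    finally show "\<bar>\<Sum>k<T. v (x k) i\<bar> \<le> \<epsilon> * T"
      using \<open>\<epsilon> > 0\<close> by (simp add: U_sum abs_le_square_iff[symmetric])
  qed
qed

lemma closed_translate: "closed F \<Longrightarrow> closed ((\<lambda>x. y + x) ` F)" for y :: real
  by (rule closed_translation)

lemma measure_window_le:
  assumes "A \<in> sets borel" "W \<in> windows"
  shows "measure lborel (A \<inter> W) \<le> measure lborel W"
proof -
  have "emeasure lborel W < \<infinity>" "open W"
    using assms emeasure_bounded_finite by (auto simp: windows_def)
  then show ?thesis using assms
    by (intro measure_mono_fmeasurable fmeasurableI) auto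
qed

lemma delta_yW_bounds:
  assumes "closed F" "W \<in> windows"
  shows "0 \<le> delta_yW y W F" "delta_yW y W F \<le> measure lborel W"
  using measure_window_le[of "F \<inter> (\<lambda>x. y + x) ` F" W] assms closed_translate[of F y]
  by (auto simp: delta_yW_def borel_closed)

text \<open>Centre the vectors at the target \<open>s\<close>. A functional exceeding
  \<open>1\<close> on every closed set would, with the constant
  \<open>c = - 1 - (\<Sum>i<q. a i * s i)\<close>, be nonnegative on all closed sets, while
  admissibility would bound its value at the target, which is \<open>- 1\<close>, below by
  \<open>0\<close>. So the greedy averaging applies, to all windows at once.\<close>

lemma admissible_average:
  fixes y :: "nat \<Rightarrow> real" and W :: "nat \<Rightarrow> real set" and \<epsilon> :: real
  assumes adm: "F_spec_cov_admissible S2" and W: "\<And>i. i < q \<Longrightarrow> W i \<in> windows"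
    and "q \<ge> 1" "\<epsilon> > 0"
  obtains T :: nat and F :: "nat \<Rightarrow> real set"
  where "T \<ge> 1" "\<And>k. closed (F k)"
    "\<And>i. i < q \<Longrightarrow> \<bar>(\<Sum>k<T. delta_yW (y i) (W i) (F k)) / T - S2 (y i) * measure lborel (W i)\<bar> \<le> \<epsilon>"
proof -
  define s where "s i = S2 (y i) * measure lborel (W i)" for i
  define v where "v F i = delta_yW (y i) (W i) F - s i" for F i
  define B where "B = (\<Sum>i<q. measure lborel (W i) + \<bar>s i\<bar>)"
  have bound: "\<bar>v F i\<bar> \<le> B" if "F \<in> Collect closed" "i < q" for F i
  proof -
    have "\<bar>v F i\<bar> \<le> measure lborel (W i) + \<bar>s i\<bar>"
      using delta_yW_bounds[of F "W i" "y i"] W that by (auto simp: v_def)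
    also have "\<dots> \<le> B"
      unfolding B_def using that by (intro member_le_sum) auto
    finally show ?thesis .
  qed
  have below: "\<exists>F\<in>Collect closed. (\<Sum>i<q. a i * v F i) \<le> 1" for a
  proof (rule ccontr)
    assume *: "\<not> ?thesis"
    define c where "c = - 1 - (\<Sum>i<q. a i * s i)"
    have "c + (\<Sum>i<q. a i * delta_yW (y i) (W i) F) \<ge> 0" if "closed F" for F
      using * that by (force simp: c_def v_def right_diff_distrib sum_subtractf)
    then have "c + (\<Sum>i<q. a i * S2 (y i) * measure lborel (W i)) \<ge> 0"
      using adm W \<open>q \<ge> 1\<close> unfolding F_spec_cov_admissible_def by blast
    then show False by (simp add: c_def s_def mult.assoc)
  qed
  obtain T F where TF: "T \<ge> (1::nat)" "\<And>k. F k \<in> Collect closed"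
    "\<And>i. i < q \<Longrightarrow> \<bar>\<Sum>k<T. v (F k) i\<bar> \<le> \<epsilon> * T"
    using greedy_average[OF bound below \<open>\<epsilon> > 0\<close>] by metis
  show thesis
  proof (rule that[OF TF(1)])
    show "closed (F k)" for k using TF(2) by simp
    fix i assume "i < q"
    have "(\<Sum>k<T. delta_yW (y i) (W i) (F k)) / T - s i = (\<Sum>k<T. v (F k) i) / T"
      using TF(1) by (simp add: v_def sum_subtractf field_simps)
    then show "\<bar>(\<Sum>k<T. delta_yW (y i) (W i) (F k)) / T - S2 (y i) * measure lborel (W i)\<bar> \<le> \<epsilon>"
      using TF(1) TF(3)[OF \<open>i < q\<close>] by (simp add: s_def field_simps)
  qed
qed

subsection \<open>A limit law on the rationals\<close>

text \<open>For \<open>u\<close> uniform in an interval, the normalised measure of this set is the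
  probability that the shifted set \<open>F - u\<close> has trace \<open>A\<close> on
  \<open>J\<close>, provided \<open>A\<close> is a subset of \<open>J\<close>.\<close>

definition trace_set :: "real set \<Rightarrow> real set \<Rightarrow> real set \<Rightarrow> real set" where
  "trace_set J A F = {u. \<forall>d\<in>J. u + d \<in> F \<longleftrightarrow> d \<in> A}"

lemma trace_set_borel:
  assumes "closed F" "finite J"
  shows "trace_set J A F \<in> sets borel"
proof -
  have "{u. u + d \<in> F \<longleftrightarrow> d \<in> A} \<in> sets borel" for d
  proof -
    have "F \<in> sets borel" using assms by (simp add: borel_closed)
    then have "Measurable.pred borel (\<lambda>u. u + d \<in> F)" by measurable
    then have "Measurable.pred borel (\<lambda>u. u + d \<in> F \<longleftrightarrow> d \<in> A)" by measurable
    then show ?thesis by (simp add: pred_def)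
  qed
  moreover have "trace_set J A F = (\<Inter>d\<in>J. {u. u + d \<in> F \<longleftrightarrow> d \<in> A})"
    by (auto simp: trace_set_def)
  ultimately show ?thesis
    using assms by (cases "J = {}") auto
qed

lemma measure_lborel_vimage_plus:
  fixes d :: real
  assumes "C \<in> sets borel"
  shows "measure lborel {u. d + u \<in> C} = measure lborel C"
proof -
  have "measure lborel C = measure (distr lborel borel ((+) d)) C"
    by (simp add: lborel_distr_plus)
  also have "\<dots> = measure lborel {u. d + u \<in> C}"
    using assms by (subst measure_distr) (auto simp: vimage_def)
  finally show ?thesis by simp
qed

lemma fmeasurable_interval: "{a<..<b::real} \<in> fmeasurable lborel"
  by (rule fmeasurableI[OF _ emeasure_bounded_finite]) auto

lemma measure_Int_interval_shift_le:
  fixes a b d :: real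
  assumes C: "C \<in> sets borel"
  shows "measure lborel (C \<inter> {a + d<..<b + d}) \<le> measure lborel (C \<inter> {a<..<b}) + \<bar>d\<bar>"
proof -
  \<comment> \<open>This interval contains all that the shifted interval gains, on the right or on
    the left.\<close>
  define I where "I = (if d \<ge> 0 then {b..b + d} else {a + d..a})"
  have I: "I \<in> fmeasurable lborel" "measure lborel I = \<bar>d\<bar>"
    by (auto simp: I_def intro!: fmeasurableI)
  have A: "C \<inter> {a<..<b} \<in> fmeasurable lborel"
    by (rule fmeasurableI2[OF fmeasurable_interval]) (use C in auto)
  have "measure lborel (C \<inter> {a + d<..<b + d}) \<le> measure lborel (C \<inter> {a<..<b} \<union> I)"
    using C I A by (intro measure_mono_fmeasurable fmeasurable.Un) (auto simp: I_def)
  also have "\<dots> \<le> measure lborel (C \<inter> {a<..<b}) + measure lborel I"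
    using A I by (intro measure_Un_le) auto
  finally show ?thesis using I by simp
qed

lemma measure_Int_interval_shift:
  fixes a b d :: real
  assumes "C \<in> sets borel"
  shows "\<bar>measure lborel (C \<inter> {a + d<..<b + d}) - measure lborel (C \<inter> {a<..<b})\<bar> \<le> \<bar>d\<bar>"
  using measure_Int_interval_shift_le[OF assms, of a d b]
    measure_Int_interval_shift_le[OF assms, of "a + d" "- d" "b + d"] by simp

text \<open>Translating the pattern by \<open>d\<close> amounts to sliding the window by
  \<open>d\<close>. The error does not depend on the length of the window, so the normalised law
  becomes shift invariant on long windows.\<close>

lemma trace_set_shift:
  assumes C: "closed F" "finite J"
  shows "\<bar>measure lborel (trace_set ((+) d ` J) ((+) d ` A) F \<inter> {a<..<b})
    - measure lborel (trace_set J A F \<inter> {a<..<b})\<bar> \<le> \<bar>d\<bar>"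
proof -
  let ?C = "trace_set J A F"
  have C: "?C \<in> sets borel" using assms by (rule trace_set_borel)
  have "trace_set ((+) d ` J) ((+) d ` A) F \<inter> {a<..<b} = {u. d + u \<in> ?C \<inter> {a + d<..<b + d}}"
    by (auto simp: trace_set_def algebra_simps image_iff)
  then have "measure lborel (trace_set ((+) d ` J) ((+) d ` A) F \<inter> {a<..<b})
      = measure lborel (?C \<inter> {a + d<..<b + d})"
    using measure_lborel_vimage_plus[of "?C \<inter> {a + d<..<b + d}" d] C by simp
  then show ?thesis using measure_Int_interval_shift[OF C] by simp
qed

text \<open>Substitute \<open>x = d + u\<close>: the conditions become that \<open>x\<close> and
  \<open>x - (d - d')\<close> lie in \<open>F\<close>. This substitution is why the window starts at
  \<open>d\<close>.\<close>

lemma trace_set_pair: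
  assumes "closed F"
  shows "measure lborel (trace_set {d, d'} {d, d'} F \<inter> {0<..<l}) = delta_yW (d - d') {d<..<d + l} F"
proof -
  let ?C = "F \<inter> (\<lambda>x. (d - d') + x) ` F \<inter> {d<..<d + l}"
  have "?C \<in> sets borel"
    using assms closed_translate[of F "d - d'"] by (intro sets.Int) (auto simp: borel_closed)
  moreover have "trace_set {d, d'} {d, d'} F \<inter> {0<..<l} = {u. d + u \<in> ?C}"
    by (auto simp: trace_set_def algebra_simps image_iff)
  ultimately show ?thesis
    unfolding delta_yW_def using measure_lborel_vimage_plus[of ?C d] by simp
qed

text \<open>The window splits according to the full trace of \<open>F - u\<close> on
  \<open>H\<close>. This is Kolmogorov consistency, exact already before any limit.\<close>

lemma trace_set_marginal:
  assumes F: "closed F" and H: "finite H" and "J \<subseteq> H" "A \<subseteq> J"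
  shows "measure lborel (trace_set J A F \<inter> {a<..<b})
    = (\<Sum>B | B \<subseteq> H \<and> B \<inter> J = A. measure lborel (trace_set H B F \<inter> {a<..<b}))"
proof -
  let ?S = "{B. B \<subseteq> H \<and> B \<inter> J = A}"
  have fin: "finite ?S" using H by (auto intro: finite_subset[of _ "Pow H"])
  have disj: "disjoint_family_on (\<lambda>B. trace_set H B F \<inter> {a<..<b}) ?S"
    unfolding disjoint_family_on_def
  proof (intro ballI impI)
    fix B B' assume "B \<in> ?S" "B' \<in> ?S" "B \<noteq> B'"
    then obtain d where "d \<in> H" "d \<in> B \<longleftrightarrow> d \<notin> B'" by blast
    then show "trace_set H B F \<inter> {a<..<b} \<inter> (trace_set H B' F \<inter> {a<..<b}) = {}"
      by (auto simp: trace_set_def)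
  qed
  have "trace_set J A F \<inter> {a<..<b} = (\<Union>B\<in>?S. trace_set H B F \<inter> {a<..<b})"
  proof (intro equalityI subsetI)
    fix u assume u: "u \<in> trace_set J A F \<inter> {a<..<b}"
    then have "{d \<in> H. u + d \<in> F} \<in> ?S" "u \<in> trace_set H {d \<in> H. u + d \<in> F} F \<inter> {a<..<b}"
      using assms by (auto simp: trace_set_def)
    then show "u \<in> (\<Union>B\<in>?S. trace_set H B F \<inter> {a<..<b})" by blast
  qed (use assms in \<open>auto simp: trace_set_def\<close>)
  moreover have "trace_set H B F \<inter> {a<..<b} \<in> fmeasurable lborel" for B
    by (rule fmeasurableI2[OF fmeasurable_interval]) (use trace_set_borel[OF F H] in auto)
  ultimately show ?thesis
    using fin disj measure_finite_Union[of ?S "\<lambda>B. trace_set H B F \<inter> {a<..<b}" lborel]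
    by (simp add: fmeasurable_def image_subset_iff less_top[symmetric] del: UN_simps)
qed

lemma interval_windows: "{a<..<b::real} \<in> windows"
proof -
  have "frontier {a<..<b} \<subseteq> {a, b}"
    by (cases "a < b") (auto simp: frontier_def interior_open)
  then have "finite (frontier {a<..<b})" by (rule finite_subset) simp
  then have "measure lborel (frontier {a<..<b}) = 0"
    by (simp add: measure_def emeasure_lborel_countable countable_finite)
  then show ?thesis by (simp add: windows_def)
qed

text \<open>All \<open>n * n\<close> pairs go into one application, the pair \<open>(i, j)\<close>
  having index \<open>i * n + j\<close>. The tolerance \<open>1\<close> belongs to a window of
  length \<open>n\<close>, so it is \<open>1 / n\<close> after normalisation.\<close>

lemma admissible_pair_average:
  fixes e :: "nat \<Rightarrow> real"
  assumes adm: "F_spec_cov_admissible S2" and "n \<ge> 1"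
  obtains T :: nat and F :: "nat \<Rightarrow> real set"
  where "T \<ge> 1" "\<And>k. closed (F k)"
    "\<And>i j. i < n \<Longrightarrow> j < n \<Longrightarrow>
      \<bar>(\<Sum>k<T. delta_yW (e i - e j) {e i<..<e i + n} (F k)) / T - S2 (e i - e j) * n\<bar> \<le> 1"
proof -
  obtain T :: nat and F :: "nat \<Rightarrow> real set" where TF: "T \<ge> 1" "\<And>k. closed (F k)"
    "\<And>i. i < n * n \<Longrightarrow> \<bar>(\<Sum>k<T. delta_yW (e (i div n) - e (i mod n)) {e (i div n)<..<e (i div n) + n} (F k)) / T
      - S2 (e (i div n) - e (i mod n)) * measure lborel {e (i div n)<..<e (i div n) + n}\<bar> \<le> 1"
    using admissible_average[OF adm, of "n * n" "\<lambda>i. {e (i div n)<..<e (i div n) + n}" 1 "\<lambda>i. e (i div n) - e (i mod n)"]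
      interval_windows \<open>n \<ge> 1\<close> by auto
  show thesis
  proof (rule that[OF TF(1,2)])
    fix i j assume ij: "i < n" "j < n"
    then have "i * n + j < Suc i * n" "Suc i * n \<le> n * n"
      using mult_le_mono1[of "Suc i" n n] by auto
    then have "i * n + j < n * n" by linarith
    moreover have "(i * n + j) div n = i" "(i * n + j) mod n = j" using ij by auto
    ultimately show "\<bar>(\<Sum>k<T. delta_yW (e i - e j) {e i<..<e i + n} (F k)) / T - S2 (e i - e j) * n\<bar> \<le> 1"
      using TF(3)[of "i * n + j"] by simp
  qed
qed

text \<open>The finite-stage laws are exactly nonnegative, normalised and consistent, while shift
  invariance and the two-point values hold up to a multiple of \<open>1 / Suc n\<close>. A pointwise
  limit along a subsequence keeps the former and makes the latter exact.\<close>

lemma limit_law: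
  assumes adm: "F_spec_cov_admissible S2"
  obtains p :: "real set \<Rightarrow> real set \<Rightarrow> real"
  where "\<And>J A. finite J \<Longrightarrow> J \<subseteq> \<rat> \<Longrightarrow> A \<subseteq> J \<Longrightarrow> p J A \<ge> 0"
    and "p {} {} = 1"
    and "\<And>H J A. finite H \<Longrightarrow> H \<subseteq> \<rat> \<Longrightarrow> J \<subseteq> H \<Longrightarrow> A \<subseteq> J \<Longrightarrow>
      p J A = (\<Sum>B | B \<subseteq> H \<and> B \<inter> J = A. p H B)"
    and "\<And>J A d. finite J \<Longrightarrow> J \<subseteq> \<rat> \<Longrightarrow> A \<subseteq> J \<Longrightarrow> d \<in> \<rat> \<Longrightarrow>
      p ((+) d ` J) ((+) d ` A) = p J A"
    and "\<And>d d'. d \<in> \<rat> \<Longrightarrow> d' \<in> \<rat> \<Longrightarrow> p {d, d'} {d, d'} = S2 (d - d')"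
proof -
  obtain e :: "nat \<Rightarrow> real" where e: "range e = \<rat>"
    using countable_rat by (metis Rats_0 empty_iff range_from_nat_into)
  have "\<forall>n. \<exists>TF. fst TF \<ge> (1::nat) \<and> (\<forall>k. closed (snd TF k)) \<and> (\<forall>i<Suc n. \<forall>j<Suc n.
      \<bar>(\<Sum>k<fst TF. delta_yW (e i - e j) {e i<..<e i + Suc n} (snd TF k)) / fst TF - S2 (e i - e j) * Suc n\<bar> \<le> 1)"
  proof
    fix n
    show "\<exists>TF. fst TF \<ge> (1::nat) \<and> (\<forall>k. closed (snd TF k)) \<and> (\<forall>i<Suc n. \<forall>j<Suc n.
      \<bar>(\<Sum>k<fst TF. delta_yW (e i - e j) {e i<..<e i + Suc n} (snd TF k)) / fst TF - S2 (e i - e j) * Suc n\<bar> \<le> 1)"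
      using admissible_pair_average[OF adm, of "Suc n" e] by (metis One_nat_def Suc_leI fst_conv snd_conv zero_less_Suc)
  qed
  then obtain TF where TF': "\<forall>n. fst (TF n) \<ge> (1::nat) \<and> (\<forall>k. closed (snd (TF n) k)) \<and> (\<forall>i<Suc n. \<forall>j<Suc n.
      \<bar>(\<Sum>k<fst (TF n). delta_yW (e i - e j) {e i<..<e i + Suc n} (snd (TF n) k)) / fst (TF n) - S2 (e i - e j) * Suc n\<bar> \<le> 1)"
    by (rule choice[THEN exE])
  define T where "T n = fst (TF n)" for n
  define F where "F n = snd (TF n)" for n
  have T: "T n \<ge> 1" and F: "closed (F n k)" for n k
    using TF' by (auto simp: T_def F_def)
  have two: "\<bar>(\<Sum>k<T n. delta_yW (e i - e j) {e i<..<e i + Suc n} (F n k)) / T n - S2 (e i - e j) * Suc n\<bar> \<le> 1"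
    if "i < Suc n" "j < Suc n" for n i j
    using TF' that by (simp add: T_def F_def)
  define m where "m n J A k = measure lborel (trace_set J A (F n k) \<inter> {0<..<real (Suc n)})" for n J A k
  \<comment> \<open>The probability of the trace pattern when the set is drawn uniformly among the
    \<open>T n\<close> chosen ones and its shift uniformly from an interval of length
    \<open>Suc n\<close>.\<close>
  define \<mu> where "\<mu> n J A = (\<Sum>k<T n. m n J A k) / T n / Suc n" for n J A
  have \<mu>_nonneg: "\<mu> n J A \<ge> 0" for n J A
    by (auto simp: \<mu>_def m_def intro!: divide_nonneg_nonneg sum_nonneg)
  have \<mu>_one: "\<mu> n {} {} = 1" for n
    using T[of n] by (simp add: \<mu>_def m_def trace_set_def)
  have \<mu>_le: "\<mu> n J A \<le> 1" if "finite J" for n J A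
  proof -
    have "m n J A k \<le> Suc n" for k
      using measure_window_le[OF trace_set_borel[OF F[of n k] that, of A] interval_windows[of 0 "real (Suc n)"]]
      by (simp add: m_def)
    then have "(\<Sum>k<T n. m n J A k) \<le> (\<Sum>k<T n. real (Suc n))"
      by (intro sum_mono)
    then show ?thesis
      using T[of n] unfolding \<mu>_def divide_divide_eq_left by (subst pos_divide_le_eq) auto
  qed
  have \<mu>_marginal: "\<mu> n J A = (\<Sum>B | B \<subseteq> H \<and> B \<inter> J = A. \<mu> n H B)"
    if "finite H" "J \<subseteq> H" "A \<subseteq> J" for n H J A
  proof -
    have "m n J A k = (\<Sum>B | B \<subseteq> H \<and> B \<inter> J = A. m n H B k)" for k
      unfolding m_def by (rule trace_set_marginal[OF F that])
    then have "(\<Sum>k<T n. m n J A k) = (\<Sum>B | B \<subseteq> H \<and> B \<inter> J = A. \<Sum>k<T n. m n H B k)"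
      using sum.swap[of "m n H" "{..<T n}" "{B. B \<subseteq> H \<and> B \<inter> J = A}"] by simp
    then show ?thesis
      by (simp add: \<mu>_def sum_divide_distrib)
  qed
  have \<mu>_shift: "\<bar>\<mu> n ((+) d ` J) ((+) d ` A) - \<mu> n J A\<bar> \<le> \<bar>d\<bar> / Suc n"
    if "finite J" for n d J A
  proof -
    have "\<bar>(\<Sum>k<T n. m n ((+) d ` J) ((+) d ` A) k) - (\<Sum>k<T n. m n J A k)\<bar>
        \<le> (\<Sum>k<T n. \<bar>m n ((+) d ` J) ((+) d ` A) k - m n J A k\<bar>)"
      by (simp add: sum_subtractf[symmetric] sum_abs)
    also have "\<dots> \<le> (\<Sum>k<T n. \<bar>d\<bar>)"
      unfolding m_def using trace_set_shift[OF F that] by (intro sum_mono)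
    finally have "\<bar>(\<Sum>k<T n. m n ((+) d ` J) ((+) d ` A) k) - (\<Sum>k<T n. m n J A k)\<bar> / T n / Suc n
        \<le> T n * \<bar>d\<bar> / T n / Suc n"
      by (intro divide_right_mono) auto
    then show ?thesis using T[of n]
      by (simp add: \<mu>_def flip: diff_divide_distrib)
  qed
  have \<mu>_pair: "\<bar>\<mu> n {e i, e j} {e i, e j} - S2 (e i - e j)\<bar> \<le> 1 / Suc n" if "i \<le> n" "j \<le> n" for n i j
  proof -
    have "\<mu> n {e i, e j} {e i, e j} - S2 (e i - e j)
      = ((\<Sum>k<T n. delta_yW (e i - e j) {e i<..<e i + Suc n} (F n k)) / T n - S2 (e i - e j) * Suc n) / Suc n"
      unfolding \<mu>_def m_def trace_set_pair[OF F] by (simp add: diff_divide_distrib)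
    then show ?thesis
      using two[of i n j] that by (simp add: divide_right_mono)
  qed
  define S where "S = {(J, A). finite J \<and> J \<subseteq> \<rat> \<and> A \<subseteq> (J::real set)}"
  have "countable ({J. finite J \<and> J \<subseteq> \<rat>} :: real set set)"
    using countable_Collect_finite_subset[OF countable_rat] by simp
  then have "countable ({J. finite J \<and> J \<subseteq> \<rat>} \<times> {J. finite J \<and> J \<subseteq> \<rat>} :: (real set \<times> real set) set)"
    by (intro countable_SIGMA)
  then have "countable S"
    by (rule countable_subset[rotated]) (auto simp: S_def intro: finite_subset)
  moreover have "norm (\<mu> n (fst x) (snd x)) \<le> 1" if "x \<in> S" for n x
    using \<mu>_nonneg \<mu>_le that by (auto simp: S_def)
  \<comment> \<open>A diagonal argument: there are only countably many patterns of finite sets of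
    rationals, and every \<open>\<mu> n\<close> takes values between \<open>0\<close> and
    \<open>1\<close> on them.\<close>
  ultimately have "\<exists>\<sigma>::nat \<Rightarrow> nat. strict_mono \<sigma> \<and> (\<forall>x\<in>S. \<exists>l. (\<lambda>n. \<mu> (\<sigma> n) (fst x) (snd x)) \<longlonglongrightarrow> l)"
    by (rule function_convergent_subsequence[where f = "\<lambda>n x. \<mu> n (fst x) (snd x)"]) auto
  then obtain \<sigma> :: "nat \<Rightarrow> nat" where "strict_mono \<sigma>"
    and conv: "\<And>x. x \<in> S \<Longrightarrow> \<exists>l. (\<lambda>n. \<mu> (\<sigma> n) (fst x) (snd x)) \<longlonglongrightarrow> l"
    by blast
  define p where "p J A = Topological_Spaces.lim (\<lambda>n. \<mu> (\<sigma> n) J A)" for J A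
  have p: "(\<lambda>n. \<mu> (\<sigma> n) J A) \<longlonglongrightarrow> p J A" if "finite J" "J \<subseteq> \<rat>" "A \<subseteq> J" for J A
  proof -
    have "(J, A) \<in> S" using that by (simp add: S_def)
    then obtain l where "(\<lambda>n. \<mu> (\<sigma> n) J A) \<longlonglongrightarrow> l" using conv by force
    then show ?thesis unfolding p_def by (metis limI)
  qed
  have null: "(\<lambda>n. c / Suc (\<sigma> n)) \<longlonglongrightarrow> 0" for c :: real
  proof -
    have "(\<lambda>n. c / Suc n) \<longlonglongrightarrow> 0"
      by (intro LIMSEQ_Suc[of "\<lambda>n. c / real n"] lim_const_over_n)
    then show ?thesis
      using LIMSEQ_subseq_LIMSEQ[OF _ \<open>strict_mono \<sigma>\<close>, of "\<lambda>n. c / Suc n" 0] by (simp add: o_def)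
  qed
  show thesis
  proof (rule that[of p])
    show "p J A \<ge> 0" if "finite J" "J \<subseteq> \<rat>" "A \<subseteq> J" for J A
      using LIMSEQ_le_const[OF p[OF that], of 0] \<mu>_nonneg by auto
    show "p {} {} = 1"
      using LIMSEQ_unique[OF p[of "{}" "{}"], of 1] \<mu>_one by simp
    show "p J A = (\<Sum>B | B \<subseteq> H \<and> B \<inter> J = A. p H B)"
      if H: "finite H" "H \<subseteq> \<rat>" "J \<subseteq> H" "A \<subseteq> J" for H J A
    proof (rule LIMSEQ_unique)
      show "(\<lambda>n. \<mu> (\<sigma> n) J A) \<longlonglongrightarrow> p J A"
        using H by (intro p) (auto intro: finite_subset)
      have "(\<lambda>n. \<Sum>B | B \<subseteq> H \<and> B \<inter> J = A. \<mu> (\<sigma> n) H B) \<longlonglongrightarrow> (\<Sum>B | B \<subseteq> H \<and> B \<inter> J = A. p H B)"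
        using H by (intro tendsto_sum p) auto
      then show "(\<lambda>n. \<mu> (\<sigma> n) J A) \<longlonglongrightarrow> (\<Sum>B | B \<subseteq> H \<and> B \<inter> J = A. p H B)"
        using \<mu>_marginal H by simp
    qed
    show "p ((+) d ` J) ((+) d ` A) = p J A"
      if J: "finite J" "J \<subseteq> \<rat>" "A \<subseteq> J" "d \<in> \<rat>" for J A d
    proof -
      have "(\<lambda>n. \<mu> (\<sigma> n) ((+) d ` J) ((+) d ` A) - \<mu> (\<sigma> n) J A) \<longlonglongrightarrow> p ((+) d ` J) ((+) d ` A) - p J A"
        using J by (intro tendsto_diff p) auto
      moreover have "(\<lambda>n. \<mu> (\<sigma> n) ((+) d ` J) ((+) d ` A) - \<mu> (\<sigma> n) J A) \<longlonglongrightarrow> 0"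
        using \<mu>_shift[OF J(1)] by (intro Lim_null_comparison[OF _ null[of "\<bar>d\<bar>"]]) simp
      ultimately show ?thesis using LIMSEQ_unique by force
    qed
    show "p {d, d'} {d, d'} = S2 (d - d')" if "d \<in> \<rat>" "d' \<in> \<rat>" for d d'
    proof -
      obtain i j where ij: "d = e i" "d' = e j" using \<open>d \<in> \<rat>\<close> \<open>d' \<in> \<rat>\<close> e by (metis imageE)
      \<comment> \<open>Stage \<open>\<sigma> n\<close> controls the pairs of indices up to
        \<open>\<sigma> n\<close>, and \<open>\<sigma> n\<close> is at least \<open>n\<close>, so
        every fixed pair is eventually controlled.\<close>
      have "eventually (\<lambda>n. n \<ge> i \<and> n \<ge> j) sequentially"
        by (simp add: eventually_ge_at_top eventually_conj)
      then have "eventually (\<lambda>n. norm (\<mu> (\<sigma> n) {d, d'} {d, d'} - S2 (d - d')) \<le> 1 / Suc (\<sigma> n)) sequentially"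
      proof eventually_elim
        case (elim n)
        then have "i \<le> \<sigma> n" "j \<le> \<sigma> n"
          using seq_suble[OF \<open>strict_mono \<sigma>\<close>, of n] by auto
        then show ?case using \<mu>_pair[of i "\<sigma> n" j] by (simp add: ij)
      qed
      then have "(\<lambda>n. \<mu> (\<sigma> n) {d, d'} {d, d'} - S2 (d - d')) \<longlonglongrightarrow> 0"
        by (rule Lim_null_comparison[OF _ null])
      then have "(\<lambda>n. \<mu> (\<sigma> n) {d, d'} {d, d'}) \<longlonglongrightarrow> S2 (d - d')"
        by (simp add: LIM_zero_iff)
      then show ?thesis using LIMSEQ_unique p[of "{d, d'}" "{d, d'}"] that by auto
    qed
  qed
qed

subsection \<open>Laws on the Effros sigma-algebra\<close>

lemma space_effros [simp]: "space effros = UNIV"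
  unfolding effros_def by (rule space_measure_of) simp

lemma effros_hit_sets:
  assumes "compact K"
  shows "{F. F \<inter> K \<noteq> {}} \<in> sets effros"
proof -
  have "{F. F \<inter> K \<noteq> {}} \<in> {{F. F \<inter> K \<noteq> {}} | K. compact K}"
    using assms by blast
  then show ?thesis unfolding effros_def by (rule in_measure_of[rotated]) simp
qed

lemma effros_measurableI:
  assumes "\<And>K. compact K \<Longrightarrow> {\<omega> \<in> space M. Z \<omega> \<inter> K \<noteq> {}} \<in> sets M"
  shows "Z \<in> measurable M effros"
  unfolding effros_def
proof (rule measurable_measure_of)
  show "Z -` A \<inter> space M \<in> sets M" if "A \<in> {{F. F \<inter> K \<noteq> {}} | K. compact K}" for A
    using that
  proof (elim CollectE exE conjE)
    fix K :: "real set" assume K: "A = {F. F \<inter> K \<noteq> {}}" "compact K"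
    have "Z -` A \<inter> space M = {\<omega> \<in> space M. Z \<omega> \<inter> K \<noteq> {}}"
      unfolding K(1) vimage_def Int_def mem_Collect_eq by (rule Collect_cong) (rule conj_commute)
    then show "Z -` A \<inter> space M \<in> sets M" using assms[OF K(2)] by (simp only:)
  qed
qed simp_all

lemma effros_mem_pred [measurable]: "Measurable.pred effros (\<lambda>F. x \<in> F)"
proof -
  have "{F \<in> space effros. x \<in> F} = {F. F \<inter> {x} \<noteq> {}}" by auto
  then show ?thesis using effros_hit_sets[of "{x}"] by (simp add: pred_def)
qed

lemma effros_cylinder_sets:
  assumes "finite J" "A \<subseteq> J"
  shows "{F. F \<inter> J = A} \<in> sets effros"
proof -
  have "{F. F \<inter> J = A} = {F \<in> space effros. \<forall>d\<in>J. d \<in> F \<longleftrightarrow> d \<in> A}"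
    using assms by auto
  also have "\<dots> \<in> sets effros"
  proof (rule sets.sets_Collect_finite_All[OF _ assms(1)])
    show "{F \<in> space effros. d \<in> F \<longleftrightarrow> d \<in> A} \<in> sets effros" for d by measurable
  qed
  finally show ?thesis .
qed

text \<open>Kolmogorov extension over the countable index set \<open>I\<close>. Patterns are coded
  as real-valued indicator functions, \<open>real\<close> being a Polish state space; the random set
  is read back as the set of coordinates with value \<open>1\<close>, hence is a subset of
  \<open>I\<close>.\<close>

lemma effros_law_exists:
  fixes p :: "real set \<Rightarrow> real set \<Rightarrow> real"
  assumes I: "countable I"
    and nonneg: "\<And>J A. finite J \<Longrightarrow> J \<subseteq> I \<Longrightarrow> A \<subseteq> J \<Longrightarrow> p J A \<ge> 0"
    and one: "p {} {} = 1"
    and marginal: "\<And>H J A. finite H \<Longrightarrow> H \<subseteq> I \<Longrightarrow> J \<subseteq> H \<Longrightarrow> A \<subseteq> J \<Longrightarrow>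
      p J A = (\<Sum>B | B \<subseteq> H \<and> B \<inter> J = A. p H B)"
  obtains Q where "prob_space Q" "sets Q = sets effros"
    "\<And>J A. finite J \<Longrightarrow> J \<subseteq> I \<Longrightarrow> A \<subseteq> J \<Longrightarrow> measure Q {F. F \<inter> J = A} = p J A"
proof -
  define chi :: "real set \<Rightarrow> real set \<Rightarrow> real \<Rightarrow> real" where "chi J A = restrict (indicator A) J" for J A
  define P where "P J = distr (point_measure (Pow J) (\<lambda>A. ennreal (p J A))) (PiM J (\<lambda>_. borel)) (chi J)" for J
  have chi_space: "chi J A \<in> space (PiM J (\<lambda>_. borel))" for J A
    by (simp add: chi_def space_PiM)
  then have chi_meas: "chi J \<in> measurable (point_measure (Pow J) f) (PiM J (\<lambda>_. borel))" for J f
    by (simp add: measurable_point_measure_eq1)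
  have P_eq: "emeasure (P J) X = (\<Sum>A | A \<subseteq> J \<and> chi J A \<in> X. ennreal (p J A))"
    if "finite J" "X \<in> sets (PiM J (\<lambda>_. borel))" for J X
  proof -
    let ?M = "point_measure (Pow J) (\<lambda>A. ennreal (p J A))"
    have "emeasure (P J) X = emeasure ?M (chi J -` X \<inter> space ?M)"
      unfolding P_def using chi_meas that(2) by (rule emeasure_distr)
    also have "\<dots> = (\<Sum>A\<in>chi J -` X \<inter> space ?M. ennreal (p J A))"
      using that(1) by (intro emeasure_point_measure_finite) (auto simp: space_point_measure)
    also have "chi J -` X \<inter> space ?M = {A. A \<subseteq> J \<and> chi J A \<in> X}"
      by (auto simp: space_point_measure)
    finally show ?thesis .
  qed
  have total: "(\<Sum>A\<in>Pow J. p J A) = 1" if "finite J" "J \<subseteq> I" for J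
  proof -
    have "p {} {} = (\<Sum>B | B \<subseteq> J \<and> B \<inter> {} = {}. p J B)"
      using that by (intro marginal) auto
    then show ?thesis using one by (simp add: Pow_def)
  qed
  interpret P: polish_projective I P
  proof (unfold polish_projective_def, rule projective_family.intro)
    fix J H assume H: "J \<subseteq> H" "finite H" "H \<subseteq> I"
    then have J: "finite J" "J \<subseteq> I" by (auto intro: finite_subset)
    show "P J = distr (P H) (PiM J (\<lambda>_. borel)) (\<lambda>f. restrict f J)"
    proof (rule measure_eqI)
      fix X assume X: "X \<in> sets (P J)"
      then have X': "X \<in> sets (PiM J (\<lambda>_. borel))" by (simp add: P_def)
      have res: "(\<lambda>f. restrict f J) \<in> measurable (PiM H (\<lambda>_. borel)) (PiM J (\<lambda>_. borel::real measure))"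
        using H by (intro measurable_restrict_subset)
      have res_chi: "restrict (chi H B) J = chi J (B \<inter> J)" for B
        using H by (auto simp: fun_eq_iff chi_def restrict_def indicator_def)
      have "emeasure (distr (P H) (PiM J (\<lambda>_. borel)) (\<lambda>f. restrict f J)) X
        = emeasure (P H) ((\<lambda>f. restrict f J) -` X \<inter> space (PiM H (\<lambda>_. borel)))"
        using res X' by (subst emeasure_distr) (auto simp: P_def)
      also have "\<dots> = (\<Sum>B | B \<subseteq> H \<and> chi J (B \<inter> J) \<in> X. ennreal (p H B))"
        using measurable_sets[OF res X'] H chi_space by (subst P_eq) (auto simp: res_chi)
      \<comment> \<open>Patterns on \<open>H\<close> are grouped by their trace on \<open>J\<close>,
        which is the form that \<open>marginal\<close> collapses.\<close>
      also have "\<dots> = (\<Sum>A | A \<subseteq> J \<and> chi J A \<in> X. \<Sum>B | B \<in> {B. B \<subseteq> H \<and> chi J (B \<inter> J) \<in> X} \<and> B \<inter> J = A. ennreal (p H B))"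
        using H J by (intro sum.group[symmetric]) auto
      also have "\<dots> = (\<Sum>A | A \<subseteq> J \<and> chi J A \<in> X. ennreal (p J A))"
      proof (intro sum.cong refl)
        fix A assume A: "A \<in> {A. A \<subseteq> J \<and> chi J A \<in> X}"
        have "(\<Sum>B | B \<in> {B. B \<subseteq> H \<and> chi J (B \<inter> J) \<in> X} \<and> B \<inter> J = A. ennreal (p H B))
            = (\<Sum>B | B \<subseteq> H \<and> B \<inter> J = A. ennreal (p H B))"
          using A by (intro sum.cong) auto
        also have "\<dots> = ennreal (\<Sum>B | B \<subseteq> H \<and> B \<inter> J = A. p H B)"
          using nonneg H by (intro sum_ennreal) auto
        finally show "(\<Sum>B | B \<in> {B. B \<subseteq> H \<and> chi J (B \<inter> J) \<in> X} \<and> B \<inter> J = A. ennreal (p H B)) = ennreal (p J A)"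
          using marginal[of H J A] H A by simp
      qed
      finally show "emeasure (P J) X = emeasure (distr (P H) (PiM J (\<lambda>_. borel)) (\<lambda>f. restrict f J)) X"
        using P_eq[OF J(1) X'] by simp
    qed (simp add: P_def)
  next
    fix J assume J: "finite J" "J \<subseteq> I"
    have "(\<Sum>A\<in>Pow J. ennreal (p J A)) = 1"
      using sum_ennreal[of "Pow J" "p J"] nonneg[OF J] total[OF J] by simp
    then have "prob_space (point_measure (Pow J) (p J))"
      using J by (intro prob_space_point_measure) auto
    then show "prob_space (P J)"
      unfolding P_def using chi_meas by (intro prob_space.prob_space_distr) auto
  qed
  define A where "A \<omega> = {d \<in> I. \<omega> d = (1::real)}" for \<omega>
  have A: "A \<in> measurable P.lim effros"
  proof (rule effros_measurableI)
    fix K :: "real set"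
    \<comment> \<open>Hitting a compact set is a countable event here because the random set lies in
      the countable set \<open>I\<close>.\<close>
    have "{\<omega> \<in> space P.lim. A \<omega> \<inter> K \<noteq> {}} = (\<Union>d\<in>I \<inter> K. {\<omega> \<in> space P.lim. \<omega> d = 1})"
      by (auto simp: A_def)
    also have "\<dots> \<in> sets P.lim"
      using I by (intro sets.countable_UN') (auto intro: countable_subset)
    finally show "{\<omega> \<in> space P.lim. A \<omega> \<inter> K \<noteq> {}} \<in> sets P.lim" .
  qed
  show thesis
  proof (rule that[of "distr P.lim effros A"])
    show "prob_space (distr P.lim effros A)"
      using A by (rule P.P.prob_space_distr)
    fix J B assume J: "finite J" "J \<subseteq> I" "B \<subseteq> J"
    define X where "X = {f \<in> space (PiM J (\<lambda>_. borel::real measure)). \<forall>d\<in>J. f d = 1 \<longleftrightarrow> d \<in> B}"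
    have X: "X \<in> sets (PiM J (\<lambda>_. borel))"
      unfolding X_def using J by measurable
    have "measure (distr P.lim effros A) {F. F \<inter> J = B} = measure P.lim (A -` {F. F \<inter> J = B} \<inter> space P.lim)"
      using A effros_cylinder_sets J by (intro measure_distr) auto
    also have "A -` {F. F \<inter> J = B} \<inter> space P.lim = P.emb I J X"
      using J by (auto simp: A_def X_def prod_emb_def space_PiM)
    also have "measure P.lim (P.emb I J X) = measure (P J) X"
      using J X by (intro P.measure_lim_emb)
    also have "\<dots> = p J B"
    proof -
      have "{A. A \<subseteq> J \<and> chi J A \<in> X} = {B}"
        using J chi_space by (auto simp: X_def chi_def indicator_def split: if_splits)
      then have "emeasure (P J) X = ennreal (p J B)"
        using P_eq[OF J(1) X] by simp
      then show ?thesis using nonneg J by (simp add: measure_def)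
    qed
    finally show "measure (distr P.lim effros A) {F. F \<inter> J = B} = p J B" .
  qed simp
qed

subsection \<open>Necessity\<close>

lemma count_space_ge_card:
  assumes "finite T" "T \<subseteq> S"
  shows "of_nat (card T) \<le> emeasure (count_space UNIV) S"
  using emeasure_mono[OF assms(2), of "count_space UNIV"] assms(1) by simp

text \<open>Connectedness of \<open>{a..b}\<close> gives a frontier point in the closed interval.
  Excluding the end points makes it interior, so that adjacent grid cells cannot share it.\<close>

lemma frontier_point_between:
  fixes F :: "real set"
  assumes "a < b" "a \<in> F \<longleftrightarrow> b \<notin> F" "a \<notin> frontier F" "b \<notin> frontier F"
  obtains x where "x \<in> frontier F" "a < x" "x < b"
proof -
  have "a \<in> {a..b}" "b \<in> {a..b}" using assms(1) by auto
  then have "{a..b} \<inter> F \<noteq> {}" "{a..b} - F \<noteq> {}" using assms(2) by blast+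
  then have "{a..b} \<inter> frontier F \<noteq> {}"
    by (rule connected_Int_frontier[OF connected_Icc])
  then obtain x where "x \<in> frontier F" "a \<le> x" "x \<le> b" by auto
  then show thesis using that assms(3,4) by (metis order_le_less)
qed

text \<open>Only the rational offsets are tested, which keeps the event in the Effros sigma-algebra while
  remaining compatible with arbitrary translations.\<close>

definition touches :: "real \<Rightarrow> real set \<Rightarrow> bool" where
  "touches x F \<longleftrightarrow> x \<in> F \<and> (\<forall>n. \<exists>q\<in>\<rat>. \<bar>q\<bar> < 1 / Suc n \<and> x + q \<notin> F)"

lemma touches_pred [measurable]: "Measurable.pred effros (touches x)"
  unfolding touches_def using countable_rat by measurable

text \<open>Near a frontier point of a closed set there is a whole ball of the complement, and it
  contains a point at a rational offset.\<close>

lemma frontier_imp_touches: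
  assumes "closed F" "x \<in> frontier F"
  shows "touches x F"
  unfolding touches_def
proof (intro conjI allI)
  show "x \<in> F" using assms by (auto simp: frontier_def)
  fix n
  have "open (- F)" using assms by (simp add: open_Compl)
  have "x \<in> closure (- F)" using assms by (simp add: frontier_closures)
  then obtain z where z: "z \<in> - F" "dist z x < 1 / Suc n"
    using closure_approachable by (metis of_nat_0_less_iff zero_less_Suc zero_less_divide_1_iff)
  then have "open (- F \<inter> ball x (1 / Suc n))" "z \<in> - F \<inter> ball x (1 / Suc n)"
    using \<open>open (- F)\<close> by (auto simp: dist_commute)
  then obtain e where "e > 0" "ball z e \<subseteq> - F \<inter> ball x (1 / Suc n)"
    using open_contains_ball by metis
  moreover obtain q where q: "q \<in> \<rat>" "z - x < q" "q < z - x + e"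
    using Rats_dense_in_real[of "z - x" "z - x + e"] \<open>e > 0\<close> by auto
  then have "x + q \<in> ball z e" by (auto simp: dist_real_def)
  ultimately have "x + q \<in> - F \<inter> ball x (1 / Suc n)" by blast
  then show "\<exists>q\<in>\<rat>. \<bar>q\<bar> < 1 / Suc n \<and> x + q \<notin> F"
    using q by (auto simp: dist_real_def)
qed

lemma touches_imp_frontier:
  assumes "touches x F"
  shows "x \<in> frontier F"
proof -
  have "x \<notin> interior F"
  proof
    assume "x \<in> interior F"
    then obtain e where e: "e > 0" "ball x e \<subseteq> F" by (auto simp: mem_interior)
    obtain n where n: "1 / Suc n < e" using e(1) by (metis inverse_eq_divide reals_Archimedean)
    obtain q where q: "\<bar>q\<bar> < 1 / Suc n" "x + q \<notin> F" using assms by (auto simp: touches_def)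
    have "x + q \<in> ball x e" using q n by (simp add: dist_real_def)
    then show False using e q by blast
  qed
  then show ?thesis using assms closure_subset by (auto simp: frontier_def touches_def)
qed

locale stationary_random_closed_set = prob_space M for M :: "'w measure" +
  fixes Z :: "'w \<Rightarrow> real set"
  assumes stationary: "stationary_racs M Z"
begin

lemma closed_Z: "\<omega> \<in> space M \<Longrightarrow> closed (Z \<omega>)"
  using stationary by (simp add: stationary_racs_def racs_def)

lemma hit_sets: "compact K \<Longrightarrow> {\<omega> \<in> space M. Z \<omega> \<inter> K \<noteq> {}} \<in> sets M"
  using stationary by (simp add: stationary_racs_def racs_def)

lemma measurable_Z [measurable]: "Z \<in> measurable M effros"
  by (rule effros_measurableI) (rule hit_sets)

lemma measurable_shift: "(\<lambda>\<omega>. (\<lambda>x. y + x) ` Z \<omega>) \<in> measurable M effros"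
proof (rule effros_measurableI)
  fix K :: "real set" assume "compact K"
  then have "compact ((\<lambda>x. - y + x) ` K)" by (rule compact_translation)
  moreover have "(\<lambda>x. y + x) ` Z \<omega> \<inter> K \<noteq> {} \<longleftrightarrow> Z \<omega> \<inter> (\<lambda>x. - y + x) ` K \<noteq> {}" for \<omega>
    by (force simp: image_iff)
  ultimately show "{\<omega> \<in> space M. (\<lambda>x. y + x) ` Z \<omega> \<inter> K \<noteq> {}} \<in> sets M"
    using hit_sets by simp
qed

lemma prob_shift:
  assumes [measurable]: "Measurable.pred effros E"
  shows "prob {\<omega> \<in> space M. E ((\<lambda>x. y + x) ` Z \<omega>)} = prob {\<omega> \<in> space M. E (Z \<omega>)}"
proof -
  have E: "{F. E F} \<in> sets effros" using assms by (simp add: pred_def)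
  have "measure (distr M effros (\<lambda>\<omega>. (\<lambda>x. y + x) ` Z \<omega>)) {F. E F} = measure (distr M effros Z) {F. E F}"
    using stationary by (simp add: stationary_racs_def)
  then show ?thesis
    using E by (simp add: measure_distr measurable_shift measurable_Z vimage_def Int_def conj_commute)
qed

text \<open>Joint measurability, as Fubini requires. Closedness lets membership be tested by
  countably many hitting events: every rational interval around \<open>x\<close> must be
  hit.\<close>

lemma pred_mem_pair [measurable]: "Measurable.pred (M \<Otimes>\<^sub>M borel) (\<lambda>(\<omega>, x). x \<in> Z \<omega>)"
proof -
  have mem: "x \<in> Z \<omega> \<longleftrightarrow> (\<forall>a\<in>\<rat>. \<forall>b\<in>\<rat>. a < x \<and> x < b \<longrightarrow> Z \<omega> \<inter> {a..b} \<noteq> {})" if "\<omega> \<in> space M" for \<omega> x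
  proof
    assume R: "\<forall>a\<in>\<rat>. \<forall>b\<in>\<rat>. a < x \<and> x < b \<longrightarrow> Z \<omega> \<inter> {a..b} \<noteq> {}"
    show "x \<in> Z \<omega>"
    proof (rule ccontr)
      assume "x \<notin> Z \<omega>"
      then have "open (- Z \<omega>)" "x \<in> - Z \<omega>" using closed_Z[OF that] by auto
      then obtain e where e: "e > 0" "ball x e \<subseteq> - Z \<omega>" using open_contains_ball by metis
      obtain a where a: "a \<in> \<rat>" "x - e < a" "a < x" using Rats_dense_in_real[of "x - e" x] e by auto
      obtain b where b: "b \<in> \<rat>" "x < b" "b < x + e" using Rats_dense_in_real[of x "x + e"] e by auto
      have "{a..b} \<subseteq> ball x e" using a b by (auto simp: dist_real_def)
      then show False using R a b e by blast
    qed
  qed auto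
  have [measurable]: "Measurable.pred M (\<lambda>\<omega>. Z \<omega> \<inter> {a..b} \<noteq> {})" for a b
    using hit_sets[of "{a..b}"] by (simp add: pred_def)
  have "Measurable.pred (M \<Otimes>\<^sub>M borel) (\<lambda>z. \<forall>a\<in>\<rat>. \<forall>b\<in>\<rat>. a < snd z \<and> snd z < b \<longrightarrow> Z (fst z) \<inter> {a..b} \<noteq> {})"
    using countable_rat by measurable
  then show ?thesis
    by (rule measurable_cong[THEN iffD1, rotated]) (auto simp: space_pair_measure mem)
qed

text \<open>The sign matches \<open>delta_yW\<close>: a point \<open>x\<close> lies in the translate
  of \<open>Z \<omega>\<close> by \<open>y\<close> exactly when \<open>x - y\<close> lies in
  \<open>Z \<omega>\<close>.\<close>

definition two_point :: "real \<Rightarrow> real" where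
  "two_point y = prob {\<omega> \<in> space M. 0 \<in> Z \<omega> \<and> - y \<in> Z \<omega>}"

lemma prob_pair: "prob {\<omega> \<in> space M. x \<in> Z \<omega> \<and> x - y \<in> Z \<omega>} = two_point y"
proof -
  have "prob {\<omega> \<in> space M. 0 \<in> Z \<omega> \<and> 0 - y \<in> Z \<omega>}
    = prob {\<omega> \<in> space M. x \<in> (\<lambda>u. x + u) ` Z \<omega> \<and> x - y \<in> (\<lambda>u. x + u) ` Z \<omega>}"
    by (intro arg_cong[where f = prob] Collect_cong) (force simp: image_iff)
  then show ?thesis
    using prob_shift[of "\<lambda>F. x \<in> F \<and> x - y \<in> F" x] by (simp add: two_point_def)
qed

text \<open>Exchange the integrals: for fixed \<open>x\<close> in \<open>W\<close>, the probability
  that \<open>x\<close> and \<open>x - y\<close> lie in the random set is the constant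
  \<open>two_point y\<close> by stationarity.\<close>

lemma delta_expectation:
  assumes W: "W \<in> windows"
  shows "integrable M (\<lambda>\<omega>. delta_yW y W (Z \<omega>))"
    and "expectation (\<lambda>\<omega>. delta_yW y W (Z \<omega>)) = two_point y * measure lborel W"
proof -
  interpret L: pair_sigma_finite M lborel ..
  have [measurable]: "W \<in> sets borel" using W by (auto simp: windows_def)
  have finW: "emeasure lborel W < \<infinity>" using W emeasure_bounded_finite by (auto simp: windows_def)
  define f where "f \<omega> x = (indicator {z. fst z \<in> W \<and> fst z \<in> Z (snd z) \<and> fst z - y \<in> Z (snd z)} (x, \<omega>) :: ennreal)" for \<omega> x
  have mem1: "Measurable.pred (M \<Otimes>\<^sub>M lborel) (\<lambda>(\<omega>, x). x \<in> Z \<omega>)"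
    using pred_mem_pair by (simp cong: measurable_cong_sets)
  have mem2: "Measurable.pred (M \<Otimes>\<^sub>M lborel) (\<lambda>(\<omega>, x). x - y \<in> Z \<omega>)"
  proof -
    have "(\<lambda>(\<omega>, x). (\<omega>, x - y)) \<in> measurable (M \<Otimes>\<^sub>M lborel) (M \<Otimes>\<^sub>M borel)" by measurable
    from measurable_compose[OF this pred_mem_pair] show ?thesis by (simp add: case_prod_unfold)
  qed
  have f: "case_prod f \<in> borel_measurable (M \<Otimes>\<^sub>M lborel)"
  proof -
    have "Measurable.pred (M \<Otimes>\<^sub>M lborel) (\<lambda>z. snd z \<in> W \<and> snd z \<in> Z (fst z) \<and> snd z - y \<in> Z (fst z))"
      using mem1 mem2 by (simp add: case_prod_unfold)
    then have "indicator {z \<in> space (M \<Otimes>\<^sub>M lborel). snd z \<in> W \<and> snd z \<in> Z (fst z) \<and> snd z - y \<in> Z (fst z)}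
      \<in> (borel_measurable (M \<Otimes>\<^sub>M lborel) :: (_ \<Rightarrow> ennreal) set)"
      unfolding pred_def by (rule borel_measurable_indicator)
    then show ?thesis
      by (rule measurable_cong[THEN iffD1, rotated]) (auto simp: f_def indicator_def)
  qed
  have delta: "ennreal (delta_yW y W (Z \<omega>)) = (\<integral>\<^sup>+x. f \<omega> x \<partial>lborel)" if "\<omega> \<in> space M" for \<omega>
  proof -
    let ?D = "Z \<omega> \<inter> (\<lambda>x. y + x) ` Z \<omega> \<inter> W"
    have D: "?D \<in> sets borel"
      using closed_Z[OF that] closed_translate[of "Z \<omega>" y] by (intro sets.Int) (auto simp: borel_closed)
    have "(\<integral>\<^sup>+x. f \<omega> x \<partial>lborel) = (\<integral>\<^sup>+x. indicator ?D x \<partial>lborel)"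
      by (intro nn_integral_cong) (auto simp: f_def indicator_def image_iff algebra_simps)
    also have "\<dots> = emeasure lborel ?D" using D by simp
    also have "\<dots> = ennreal (delta_yW y W (Z \<omega>))"
      unfolding delta_yW_def
    proof (rule emeasure_eq_ennreal_measure)
      have "emeasure lborel ?D \<le> emeasure lborel W" by (intro emeasure_mono) auto
      then show "emeasure lborel ?D \<noteq> top" using finW by auto
    qed
    finally show ?thesis by simp
  qed
  have meas: "(\<lambda>\<omega>. delta_yW y W (Z \<omega>)) \<in> borel_measurable M"
  proof -
    \<comment> \<open>The inner integral of a jointly measurable function is measurable; on the
      space it equals the functional in question.\<close>
    have "(\<lambda>\<omega>. enn2real (\<integral>\<^sup>+x. f \<omega> x \<partial>lborel)) \<in> borel_measurable M"
      using lborel.borel_measurable_nn_integral[OF f] by simp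
    then show ?thesis
      by (rule measurable_cong[THEN iffD1, rotated])
        (simp add: delta[symmetric] delta_yW_def)
  qed
  show int: "integrable M (\<lambda>\<omega>. delta_yW y W (Z \<omega>))"
    using meas delta_yW_bounds[OF closed_Z W]
    by (intro integrable_const_bound[where B = "measure lborel W"]) auto
  have slice: "(\<integral>\<^sup>+\<omega>. f \<omega> x \<partial>M) = ennreal (two_point y) * indicator W x" for x
  proof -
    let ?E = "{\<omega> \<in> space M. x \<in> Z \<omega> \<and> x - y \<in> Z \<omega>}"
    have E: "?E \<in> sets M" by measurable
    have "(\<integral>\<^sup>+\<omega>. f \<omega> x \<partial>M) = (\<integral>\<^sup>+\<omega>. indicator W x * indicator ?E \<omega> \<partial>M)"
      by (intro nn_integral_cong) (auto simp: f_def indicator_def)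
    also have "\<dots> = indicator W x * emeasure M ?E"
      using E by (simp add: nn_integral_cmult)
    finally show ?thesis by (simp add: emeasure_eq_measure prob_pair mult.commute)
  qed
  have "(\<integral>\<^sup>+\<omega>. ennreal (delta_yW y W (Z \<omega>)) \<partial>M) = (\<integral>\<^sup>+\<omega>. (\<integral>\<^sup>+x. f \<omega> x \<partial>lborel) \<partial>M)"
    by (intro nn_integral_cong delta)
  also have "\<dots> = (\<integral>\<^sup>+x. (\<integral>\<^sup>+\<omega>. f \<omega> x \<partial>M) \<partial>lborel)"
    using L.Fubini'[OF f] by simp
  also have "\<dots> = ennreal (two_point y) * emeasure lborel W"
    by (simp add: slice nn_integral_cmult)
  also have "\<dots> = ennreal (two_point y * measure lborel W)"
    using finW by (simp add: emeasure_eq_ennreal_measure ennreal_mult two_point_def less_top)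
  finally show "expectation (\<lambda>\<omega>. delta_yW y W (Z \<omega>)) = two_point y * measure lborel W"
    using meas delta_yW_bounds[OF closed_Z W]
    by (subst integral_eq_nn_integral) (auto simp: two_point_def)
qed

lemma specific_covariogram_eq: "specific_covariogram M Z y = two_point y"
  using delta_expectation(2)[OF interval_windows[of 0 1], of y]
  by (simp add: specific_covariogram_def delta_yW_def)

text \<open>Every realization is closed, so the assumed inequality holds pointwise and survives
  taking expectations, which are linear.\<close>

lemma admissible: "F_spec_cov_admissible (specific_covariogram M Z)"
  unfolding F_spec_cov_admissible_def specific_covariogram_eq
proof (intro allI impI)
  fix q :: nat and a y :: "nat \<Rightarrow> real" and W :: "nat \<Rightarrow> real set" and c :: real
  assume W: "\<forall>i<q. W i \<in> windows"
    and pos: "\<forall>F. closed F \<longrightarrow> 0 \<le> c + (\<Sum>i<q. a i * delta_yW (y i) (W i) F)"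
  have int: "integrable M (\<lambda>\<omega>. \<Sum>i<q. a i * delta_yW (y i) (W i) (Z \<omega>))"
    using W delta_expectation(1) by (intro Bochner_Integration.integrable_sum integrable_mult_right) auto
  have "0 \<le> expectation (\<lambda>\<omega>. c + (\<Sum>i<q. a i * delta_yW (y i) (W i) (Z \<omega>)))"
    using pos closed_Z by (intro integral_nonneg_AE) auto
  also have "\<dots> = c + expectation (\<lambda>\<omega>. \<Sum>i<q. a i * delta_yW (y i) (W i) (Z \<omega>))"
    using int by (simp add: prob_space)
  also have "expectation (\<lambda>\<omega>. \<Sum>i<q. a i * delta_yW (y i) (W i) (Z \<omega>))
      = (\<Sum>i<q. expectation (\<lambda>\<omega>. a i * delta_yW (y i) (W i) (Z \<omega>)))"
    using W delta_expectation(1) by (intro Bochner_Integration.integral_sum integrable_mult_right) auto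
  also have "\<dots> = (\<Sum>i<q. a i * two_point (y i) * measure lborel (W i))"
    using W delta_expectation(2) by (intro sum.cong) auto
  finally show "0 \<le> c + (\<Sum>i<q. a i * two_point (y i) * measure lborel (W i))" .
qed

section \<open>Changes of membership between two points\<close>

definition discrepancy :: "real \<Rightarrow> real" where
  "discrepancy h = prob {\<omega> \<in> space M. 0 \<in> Z \<omega> \<longleftrightarrow> h \<notin> Z \<omega>}"

lemma discrepancy_nonneg: "0 \<le> discrepancy h"
  by (simp add: discrepancy_def)

lemma prob_discrepancy: "prob {\<omega> \<in> space M. x \<in> Z \<omega> \<longleftrightarrow> x + h \<notin> Z \<omega>} = discrepancy h"
proof -
  have "prob {\<omega> \<in> space M. 0 \<in> Z \<omega> \<longleftrightarrow> h \<notin> Z \<omega>}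
    = prob {\<omega> \<in> space M. x \<in> (\<lambda>u. x + u) ` Z \<omega> \<longleftrightarrow> x + h \<notin> (\<lambda>u. x + u) ` Z \<omega>}"
    by (intro arg_cong[where f = prob] Collect_cong) (force simp: image_iff)
  then show ?thesis
    using prob_shift[of "\<lambda>F. x \<in> F \<longleftrightarrow> x + h \<notin> F" x] by (simp add: discrepancy_def)
qed

lemma discrepancy_minus: "discrepancy (- h) = discrepancy h"
proof -
  have "{\<omega> \<in> space M. 0 \<in> Z \<omega> \<longleftrightarrow> - h \<notin> Z \<omega>} = {\<omega> \<in> space M. - h \<in> Z \<omega> \<longleftrightarrow> - h + h \<notin> Z \<omega>}"
    by auto
  then show ?thesis using prob_discrepancy[of "- h" h] by (simp only: discrepancy_def)
qed

text \<open>A change over \<open>m\<close> steps forces a change in one of them, and by stationarity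
  each step has the same probability of a change.\<close>

lemma discrepancy_mult_le: "discrepancy (real m * h) \<le> m * discrepancy h"
proof (induction m)
  case 0
  then show ?case by (simp add: discrepancy_def)
next
  case (Suc m)
  let ?A = "{\<omega> \<in> space M. 0 \<in> Z \<omega> \<longleftrightarrow> m * h \<notin> Z \<omega>}"
  let ?B = "{\<omega> \<in> space M. m * h \<in> Z \<omega> \<longleftrightarrow> m * h + h \<notin> Z \<omega>}"
  have [measurable]: "?A \<in> sets M" "?B \<in> sets M" by measurable
  have "discrepancy (Suc m * h) \<le> prob (?A \<union> ?B)"
    unfolding discrepancy_def by (intro finite_measure_mono) (auto simp: algebra_simps)
  also have "\<dots> \<le> prob ?A + prob ?B" by (intro measure_Un_le) auto
  also have "prob ?B = discrepancy h" by (rule prob_discrepancy)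
  also have "prob ?A = discrepancy (m * h)" by (simp add: discrepancy_def)
  finally show ?case using Suc by (simp add: algebra_simps)
qed

text \<open>Both points belong to the set with the same probability, so the two directions of change
  are equally likely. This is the origin of the factor \<open>1/2\<close> in the Lipschitz
  constant.\<close>

lemma prob_in_minus_notin:
  "prob {\<omega> \<in> space M. a \<in> Z \<omega> \<and> b \<notin> Z \<omega>} = discrepancy (b - a) / 2"
proof -
  let ?P = "\<lambda>x. {\<omega> \<in> space M. x \<in> Z \<omega>}"
  have P: "prob (?P x) = two_point 0" for x
    using prob_pair[of x 0] by simp
  have eq: "prob {\<omega> \<in> space M. a \<in> Z \<omega> \<and> b \<notin> Z \<omega>} = prob (?P a) - prob (?P a \<inter> ?P b)" for a b
  proof -
    have "{\<omega> \<in> space M. a \<in> Z \<omega> \<and> b \<notin> Z \<omega>} = ?P a - ?P a \<inter> ?P b" by auto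
    then show ?thesis by (simp only:) (rule finite_measure_Diff; measurable; auto)
  qed
  have "discrepancy (b - a) = prob {\<omega> \<in> space M. a \<in> Z \<omega> \<longleftrightarrow> b \<notin> Z \<omega>}"
    using prob_discrepancy[of a "b - a"] by simp
  also have "{\<omega> \<in> space M. a \<in> Z \<omega> \<longleftrightarrow> b \<notin> Z \<omega>}
    = {\<omega> \<in> space M. a \<in> Z \<omega> \<and> b \<notin> Z \<omega>} \<union> {\<omega> \<in> space M. b \<in> Z \<omega> \<and> a \<notin> Z \<omega>}" by auto
  also have "prob \<dots> = prob {\<omega> \<in> space M. a \<in> Z \<omega> \<and> b \<notin> Z \<omega>} + prob {\<omega> \<in> space M. b \<in> Z \<omega> \<and> a \<notin> Z \<omega>}"
    by (rule finite_measure_Union) (measurable, auto)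
  finally show ?thesis by (simp add: eq P Int_commute)
qed

text \<open>When \<open>0\<close> and \<open>- x\<close> lie in the set, either \<open>- y\<close>
  does as well or there is a change in a prescribed direction from \<open>- x\<close> to
  \<open>- y\<close>.\<close>

lemma two_point_diff_le: "two_point x - two_point y \<le> discrepancy (x - y) / 2"
proof -
  have "two_point x \<le> prob ({\<omega> \<in> space M. 0 \<in> Z \<omega> \<and> - y \<in> Z \<omega>} \<union> {\<omega> \<in> space M. - x \<in> Z \<omega> \<and> - y \<notin> Z \<omega>})"
    unfolding two_point_def by (intro finite_measure_mono) (auto intro!: sets.Un)
  also have "\<dots> \<le> two_point y + discrepancy (x - y) / 2"
    using prob_in_minus_notin[of "- x" "- y"]
    by (intro order_trans[OF measure_Un_le]) (auto simp: two_point_def)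
  finally show ?thesis by simp
qed

context
  fixes r :: real
  assumes r: "expected_boundary_count M Z \<le> ennreal r"
begin

text \<open>All points are touched with the same probability \<open>\<pi>\<close>. Any
  \<open>m\<close> distinct points of the open unit interval contribute \<open>m * \<pi>\<close> to
  the expected boundary count, which is bounded, so \<open>\<pi>\<close> vanishes. The bound uses
  \<open>max r 0\<close> because \<open>r\<close> has no sign yet and \<open>ennreal\<close>
  truncates negative values.\<close>

lemma prob_touches: "prob {\<omega> \<in> space M. touches x (Z \<omega>)} = 0"
proof -
  define \<pi> where "\<pi> = prob {\<omega> \<in> space M. touches 0 (Z \<omega>)}"
  have touch: "prob {\<omega> \<in> space M. touches x (Z \<omega>)} = \<pi>" for x
  proof -
    have "touches x ((\<lambda>u. x + u) ` Z \<omega>) \<longleftrightarrow> touches 0 (Z \<omega>)" for \<omega>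
      by (simp add: touches_def image_iff)
    then show ?thesis using prob_shift[of "touches x" x] by (simp add: \<pi>_def)
  qed
  have "\<pi> \<ge> 0" by (simp add: \<pi>_def)
  have bound: "m * \<pi> \<le> max r 0" for m :: nat
  proof -
    \<comment> \<open>Both successors matter: for \<open>i < m\<close> the points stay strictly
      between \<open>0\<close> and \<open>1\<close>.\<close>
    define t where "t i = real (Suc i) / real (Suc m)" for i
    have inj: "inj t" by (auto simp: inj_on_def t_def)
    let ?E = "\<lambda>i. {\<omega> \<in> space M. touches (t i) (Z \<omega>)}"
    have "ennreal (m * \<pi>) = (\<Sum>i<m. emeasure M (?E i))"
      using \<open>\<pi> \<ge> 0\<close> by (simp add: emeasure_eq_measure touch ennreal_mult ennreal_of_nat_eq_real_of_nat)
    also have "\<dots> = (\<integral>\<^sup>+\<omega>. (\<Sum>i<m. indicator (?E i) \<omega>) \<partial>M)"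
      by (subst nn_integral_sum) auto
    also have "\<dots> \<le> expected_boundary_count M Z"
      unfolding expected_boundary_count_def
    proof (rule nn_integral_mono)
      fix \<omega> assume \<omega>: "\<omega> \<in> space M"
      let ?I = "{i. i < m \<and> touches (t i) (Z \<omega>)}"
      have "(\<Sum>i<m. indicator (?E i) \<omega> :: ennreal) = of_nat (card ?I)"
        using \<omega> by (simp add: indicator_def sum.If_cases Int_def)
      also have "card ?I = card (t ` ?I)"
        using inj by (intro card_image[symmetric]) (auto intro: inj_on_subset)
      also have "of_nat (card (t ` ?I)) \<le> emeasure (count_space UNIV) (frontier (Z \<omega>) \<inter> {0<..<1})"
        by (intro count_space_ge_card) (auto simp: t_def intro: touches_imp_frontier)
      finally show "(\<Sum>i<m. indicator (?E i) \<omega>) \<le> emeasure (count_space UNIV) (frontier (Z \<omega>) \<inter> {0<..<1})" .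
    qed
    also note r
    finally show ?thesis by (auto simp: ennreal_le_iff2 le_max_iff_disj)
  qed
  have "\<pi> = 0"
  proof (rule ccontr)
    assume "\<pi> \<noteq> 0"
    then have "0 < \<pi>" using \<open>\<pi> \<ge> 0\<close> by simp
    then obtain m :: nat where "max r 0 < m * \<pi>"
      using reals_Archimedean3 by blast
    then show False using bound[of m] by linarith
  qed
  then show ?thesis by (simp add: touch)
qed

text \<open>Almost surely no grid point is a boundary point, so each change across a cell yields a
  boundary point in the open cell. The cells are disjoint and lie in the unit interval, so the
  expected number of changes is at most the expected boundary count.\<close>

lemma mult_discrepancy_le:
  assumes h: "h > 0" "real n * h \<le> 1" and "r > 0"
  shows "n * discrepancy h \<le> r"
proof -
  let ?E = "\<lambda>i. {\<omega> \<in> space M. i * h \<in> Z \<omega> \<longleftrightarrow> i * h + h \<notin> Z \<omega>}"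
  have "AE \<omega> in M. \<not> touches (real i * h) (Z \<omega>)" for i :: nat
    by (intro AE_I[of _ _ "{\<omega> \<in> space M. touches (real i * h) (Z \<omega>)}"])
      (auto simp: emeasure_eq_measure prob_touches)
  then have AE: "AE \<omega> in M. \<forall>i::nat. \<not> touches (real i * h) (Z \<omega>)"
    by (simp add: AE_all_countable)
  have "ennreal (n * discrepancy h) = (\<Sum>i<n. emeasure M (?E (real i)))"
    by (simp add: emeasure_eq_measure prob_discrepancy ennreal_mult ennreal_of_nat_eq_real_of_nat discrepancy_nonneg)
  also have "\<dots> = (\<integral>\<^sup>+\<omega>. (\<Sum>i<n. indicator (?E (real i)) \<omega>) \<partial>M)"
    by (subst nn_integral_sum) auto
  also have "\<dots> \<le> expected_boundary_count M Z"
    unfolding expected_boundary_count_def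
  proof (rule nn_integral_mono_AE)
    show "AE \<omega> in M. (\<Sum>i<n. indicator (?E (real i)) \<omega>) \<le> emeasure (count_space UNIV) (frontier (Z \<omega>) \<inter> {0<..<1})"
      using AE AE_space
    proof eventually_elim
      fix \<omega> assume nt: "\<forall>i::nat. \<not> touches (real i * h) (Z \<omega>)" and \<omega>: "\<omega> \<in> space M"
      let ?I = "{i. i < n \<and> (real i * h \<in> Z \<omega> \<longleftrightarrow> real i * h + h \<notin> Z \<omega>)}"
      have nf: "real i * h \<notin> frontier (Z \<omega>)" for i :: nat
        using nt frontier_imp_touches[OF closed_Z[OF \<omega>]] by blast
      have "\<exists>x. x \<in> frontier (Z \<omega>) \<and> real i * h < x \<and> x < real i * h + h" if "i \<in> ?I" for i
      proof (rule frontier_point_between[of "real i * h" "real i * h + h" "Z \<omega>"])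
        show "real i * h + h \<notin> frontier (Z \<omega>)"
          using nf[of "Suc i"] by (simp add: algebra_simps)
      qed (use nf that h in auto)
      then have "\<exists>x. \<forall>i\<in>?I. x i \<in> frontier (Z \<omega>) \<and> real i * h < x i \<and> x i < real i * h + h"
        by (intro bchoice ballI)
      then obtain x where x: "\<And>i. i \<in> ?I \<Longrightarrow> x i \<in> frontier (Z \<omega>) \<and> real i * h < x i \<and> x i < real i * h + h"
        by blast
      have mono: "real i * h + h \<le> real j * h" if "i < j" for i j :: nat
      proof -
        have "(real i + 1) * h \<le> real j * h" using that h by (intro mult_right_mono) auto
        then show ?thesis by (simp add: algebra_simps)
      qed
      have inj: "inj_on x ?I"
      proof (rule linorder_inj_onI)
        fix i j assume ij: "i < j" "i \<in> ?I" "j \<in> ?I"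
        then show "x i \<noteq> x j" using x[OF ij(2)] x[OF ij(3)] mono[OF ij(1)] by linarith
      qed auto
      have "x ` ?I \<subseteq> frontier (Z \<omega>) \<inter> {0<..<1}"
      proof (rule image_subsetI)
        fix i assume i: "i \<in> ?I"
        have "0 \<le> real i * h" using h by simp
        moreover have "real i * h + h \<le> real n * h" using mono[of i n] i by simp
        ultimately have "0 < x i" "x i < 1" using x[OF i] h(2) by linarith+
        then show "x i \<in> frontier (Z \<omega>) \<inter> {0<..<1}" using x[OF i] by simp
      qed
      then have "of_nat (card (x ` ?I)) \<le> emeasure (count_space UNIV) (frontier (Z \<omega>) \<inter> {0<..<1})"
        by (intro count_space_ge_card) auto
      moreover have "(\<Sum>i<n. indicator (?E (real i)) \<omega> :: ennreal) = of_nat (card ?I)"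
        using \<omega> by (simp add: indicator_def sum.If_cases Int_def)
      ultimately show "(\<Sum>i<n. indicator (?E (real i)) \<omega>) \<le> emeasure (count_space UNIV) (frontier (Z \<omega>) \<inter> {0<..<1})"
        using card_image[OF inj] by simp
    qed
  qed
  also note r
  finally show ?thesis using \<open>r > 0\<close> by simp
qed

text \<open>Pass to steps of length \<open>h / M\<close>: about \<open>M / h\<close> of them fit
  into the unit interval, and \<open>M\<close> of them make up \<open>h\<close>. Comparing the two
  counts gives the slope \<open>r\<close> up to a rounding error that vanishes as \<open>M\<close>
  grows.\<close>

lemma discrepancy_le:
  assumes "r > 0"
  shows "discrepancy h \<le> r * \<bar>h\<bar>"
proof -
  have pos: "discrepancy h \<le> r * h" if h: "h > 0" for h
  proof (rule LIMSEQ_le_const)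
    have "(\<lambda>m. h / real (Suc m)) \<longlonglongrightarrow> 0"
      by (intro LIMSEQ_Suc[of "\<lambda>n. h / real n"] lim_const_over_n)
    then have "(\<lambda>m. r * h + discrepancy h * (h / real (Suc m))) \<longlonglongrightarrow> r * h + discrepancy h * 0"
      by (intro tendsto_intros)
    then show "(\<lambda>m. r * h + discrepancy h * (h / real (Suc m))) \<longlonglongrightarrow> r * h" by simp
    have "discrepancy h \<le> r * h + discrepancy h * (h / real (Suc m))" for m
    proof -
      define M where "M = real (Suc m)"
      \<comment> \<open>The number of whole steps of length \<open>h / M\<close> in the unit
        interval; rounding down loses at most one step, which is the \<open>- 1\<close>
        below.\<close>
      define n where "n = nat \<lfloor>M / h\<rfloor>"
      have M: "M > 0" by (simp add: M_def)
      have "M / h > 0" using M h by simp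
      then have n: "real n \<le> M / h" "M / h \<le> real n + 1" by (simp_all add: n_def)
      have "n * discrepancy (h / M) \<le> r"
        using n M h \<open>r > 0\<close> by (intro mult_discrepancy_le) (auto simp: field_simps)
      moreover have "discrepancy h \<le> M * discrepancy (h / M)"
        using discrepancy_mult_le[of "Suc m" "h / M"] M by (simp add: M_def)
      moreover have "0 \<le> discrepancy (h / M)" by (simp add: discrepancy_def)
      ultimately have "n * discrepancy h \<le> M * r"
        using M by (smt (verit) mult.left_commute mult_left_mono of_nat_0_le_iff)
      moreover have "(M / h - 1) * discrepancy h \<le> n * discrepancy h"
        using n by (intro mult_right_mono) (auto simp: discrepancy_def)
      ultimately have "(M / h - 1) * discrepancy h \<le> M * r" by simp
      then have "(h / M) * ((M / h - 1) * discrepancy h) \<le> (h / M) * (M * r)"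
        using M h by (intro mult_left_mono) auto
      moreover have "(h / M) * ((M / h - 1) * discrepancy h) = discrepancy h - discrepancy h * (h / M)"
        using M h by (simp add: field_simps)
      moreover have "(h / M) * (M * r) = r * h" using M by simp
      ultimately have "discrepancy h \<le> r * h + discrepancy h * (h / M)" by linarith
      then show ?thesis by (simp only: M_def)
    qed
    then show "\<exists>N. \<forall>m\<ge>N. discrepancy h \<le> r * h + discrepancy h * (h / real (Suc m))" by blast
  qed
  show ?thesis
  proof (cases h "0::real" rule: linorder_cases)
    case less
    then show ?thesis using pos[of "- h"] discrepancy_minus[of h] by simp
  next
    case equal
    then show ?thesis by (simp add: discrepancy_def)
  next
    case greater
    then show ?thesis using pos by simp
  qed
qed

lemma covariogram_lipschitz:
  assumes "r > 0"
  shows "(r / 2)-lipschitz_on UNIV (specific_covariogram M Z)"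
proof (rule lipschitz_onI)
  fix x y :: real
  have "two_point x - two_point y \<le> r / 2 * \<bar>x - y\<bar>" for x y
    using two_point_diff_le[of x y] discrepancy_le[OF assms, of "x - y"] by simp
  from this[of x y] this[of y x]
  have "\<bar>two_point x - two_point y\<bar> \<le> r / 2 * \<bar>x - y\<bar>"
    unfolding abs_minus_commute[of y x] by linarith
  then show "dist (specific_covariogram M Z x) (specific_covariogram M Z y) \<le> r / 2 * dist x y"
    by (simp add: specific_covariogram_eq dist_real_def)
qed (use assms in simp)

end

end

subsection \<open>Sufficiency\<close>

text \<open>Avoidance events, unlike hitting events, are stable under intersection: missing
  \<open>K\<close> and \<open>L\<close> is missing their union. So the avoidance probabilities of
  compact sets determine the law.\<close>

lemma effros_measure_eqI:
  assumes "finite_measure M" "finite_measure N" "sets M = sets effros" "sets N = sets effros"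
    and eq: "\<And>K. compact K \<Longrightarrow> measure M {F. F \<inter> K = {}} = measure N {F. F \<inter> K = {}}"
  shows "M = N"
proof -
  interpret M: finite_measure M by fact
  interpret N: finite_measure N by fact
  define E where "E = (\<lambda>K. {F::real set. F \<inter> K = {}}) ` Collect compact"
  have compl: "UNIV - {F::real set. F \<inter> K = {}} = {F. F \<inter> K \<noteq> {}}" for K by auto
  have hit_compl: "UNIV - {F::real set. F \<inter> K \<noteq> {}} = {F. F \<inter> K = {}}" for K by auto
  have gen: "sets effros = sigma_sets UNIV E"
  proof
    have "(\<lambda>K. {F. F \<inter> K \<noteq> {}}) ` Collect compact \<subseteq> sigma_sets UNIV E"
    proof (rule image_subsetI)
      fix K :: "real set" assume "K \<in> Collect compact"
      then have "{F. F \<inter> K = {}} \<in> sigma_sets UNIV E" by (intro sigma_sets.Basic) (simp add: E_def)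
      from sigma_sets.Compl[OF this] show "{F. F \<inter> K \<noteq> {}} \<in> sigma_sets UNIV E"
        by (simp only: compl)
    qed
    moreover have "sets effros = sigma_sets UNIV ((\<lambda>K. {F. F \<inter> K \<noteq> {}}) ` Collect compact)"
      unfolding effros_def by (subst sets_measure_of) (simp_all add: image_Collect)
    ultimately show "sets effros \<subseteq> sigma_sets UNIV E"
      by (simp only: sigma_sets_mono)
    have "E \<subseteq> sets effros"
      unfolding E_def
    proof (rule image_subsetI)
      fix K :: "real set" assume "K \<in> Collect compact"
      then have "space effros - {F. F \<inter> K \<noteq> {}} \<in> sets effros"
        by (intro sets.compl_sets effros_hit_sets) simp
      then show "{F. F \<inter> K = {}} \<in> sets effros"
        by (simp only: space_effros hit_compl)
    qed
    then show "sigma_sets UNIV E \<subseteq> sets effros"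
      using sets.sigma_sets_subset[of E effros] by simp
  qed
  show ?thesis
  proof (rule measure_eqI_generator_eq[where E = E and \<Omega> = UNIV and A = "\<lambda>_. UNIV"])
    show "Int_stable E"
    proof (rule Int_stableI)
      fix a b assume "a \<in> E" "b \<in> E"
      obtain K where a: "a = {F. F \<inter> K = {}}" and K: "K \<in> Collect compact"
        using \<open>a \<in> E\<close> unfolding E_def by (rule imageE)
      obtain L where b: "b = {F. F \<inter> L = {}}" and L: "L \<in> Collect compact"
        using \<open>b \<in> E\<close> unfolding E_def by (rule imageE)
      have "K \<union> L \<in> Collect compact" using K L by (simp add: compact_Un)
      moreover have "a \<inter> b = {F. F \<inter> (K \<union> L) = {}}" unfolding a b by auto
      ultimately show "a \<inter> b \<in> E" unfolding E_def by (rule rev_image_eqI)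
    qed
    show "emeasure M X = emeasure N X" if X: "X \<in> E" for X
    proof -
      obtain K where X': "X = {F. F \<inter> K = {}}" and K: "K \<in> Collect compact"
        using X unfolding E_def by (rule imageE)
      show ?thesis
        using eq[of K] K unfolding X' by (simp add: M.emeasure_eq_measure N.emeasure_eq_measure)
    qed
    show "range (\<lambda>_. UNIV) \<subseteq> E"
      unfolding E_def by (rule image_subsetI, rule image_eqI[of _ _ "{}"]) auto
    show "sets M = sigma_sets UNIV E" "sets N = sigma_sets UNIV E" using assms gen by auto
  qed auto
qed

text \<open>A count is the supremum over finite subsets. This allows bounding a possibly infinite
  boundary by treating finitely many points at a time.\<close>

lemma emeasure_count_space_le:
  assumes "\<And>T. finite T \<Longrightarrow> T \<subseteq> S \<Longrightarrow> of_nat (card T) \<le> c"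
  shows "emeasure (count_space UNIV) S \<le> c"
proof (cases "finite S")
  case True
  then show ?thesis using assms[of S] by simp
next
  case False
  have bound: "of_nat n \<le> c" for n
  proof -
    obtain T where "finite T" "card T = n" "T \<subseteq> S"
      using infinite_arbitrarily_large[OF False, of n] by blast
    then show ?thesis using assms[of T] by simp
  qed
  have "c = top"
  proof (rule ccontr)
    assume "c \<noteq> top"
    then obtain n where "c < of_nat n" using ennreal_Ex_less_of_nat less_top by blast
    then show False using bound[of n] by simp
  qed
  then show ?thesis by simp
qed

section \<open>Counting changes of membership along refining grids\<close>

text \<open>With denominators \<open>n!\<close>, every rational point lies on all sufficiently fine grids.\<close>

definition grid :: "real \<Rightarrow> real \<Rightarrow> nat \<Rightarrow> nat \<Rightarrow> real" where
  "grid a l n k = a + k * (l / fact n)"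

definition transitions :: "real \<Rightarrow> real \<Rightarrow> nat \<Rightarrow> real set \<Rightarrow> nat set" where
  "transitions a l n F = {k. k < fact n \<and> (grid a l n k \<in> F \<longleftrightarrow> grid a l n (Suc k) \<notin> F)}"

lemma finite_transitions [simp]: "finite (transitions a l n F)"
  by (simp add: transitions_def)

lemma grid_mono: "l \<ge> 0 \<Longrightarrow> i \<le> j \<Longrightarrow> grid a l n i \<le> grid a l n j"
  by (auto simp: grid_def intro!: mult_right_mono divide_right_mono)

lemma grid_rat: "a \<in> \<rat> \<Longrightarrow> l \<in> \<rat> \<Longrightarrow> grid a l n k \<in> \<rat>"
proof -
  assume "a \<in> \<rat>" "l \<in> \<rat>"
  moreover have "(fact n :: real) \<in> \<rat>" using Rats_of_nat[of "fact n"] by simp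
  ultimately show "grid a l n k \<in> \<rat>" unfolding grid_def by auto
qed

lemma eventually_on_grid:
  assumes "a \<in> \<rat>" "l \<in> \<rat>" "l > 0" "q \<in> \<rat>" "q \<in> {a..a + l}"
  shows "eventually (\<lambda>n. \<exists>k\<le>fact n. q = grid a l n k) sequentially"
proof -
  have "(q - a) / l \<in> \<rat>" "(q - a) / l \<ge> 0" using assms by auto
  then obtain i j :: nat where ij: "j \<noteq> 0" "(q - a) / l = real i / real j"
    using Rats_abs_nat_div_natE by (metis abs_of_nonneg)
  have "i \<le> j"
  proof -
    have "(q - a) / l \<le> 1" using assms by simp
    then show ?thesis using ij by (simp add: field_simps)
  qed
  show ?thesis
    using eventually_ge_at_top[of j]
  proof eventually_elim
    case (elim n)
    then have "j dvd fact n" using ij by (intro dvd_fact) auto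
    then obtain c where c: "fact n = j * c" by (elim dvdE)
    have c': "(fact n :: real) = real j * real c" using arg_cong[OF c, of real] by simp
    have "c \<noteq> 0" using c by (metis fact_nonzero mult_0_right)
    have "q = a + l * (real i / real j)" using ij(2) \<open>l > 0\<close> by (simp add: field_simps)
    also have "\<dots> = grid a l n (i * c)"
      unfolding grid_def c' using \<open>c \<noteq> 0\<close> ij(1) by (simp add: field_simps)
    finally have "q = grid a l n (i * c)" .
    moreover have "i * c \<le> fact n" unfolding c using \<open>i \<le> j\<close> by (rule mult_le_mono1)
    ultimately show ?case by blast
  qed
qed

text \<open>A discrete intermediate value theorem, by induction on the right end.\<close>

lemma transition_between:
  assumes "i \<le> j" "j \<le> fact n" "grid a l n i \<in> F \<longleftrightarrow> grid a l n j \<notin> F"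
  shows "\<exists>k\<in>transitions a l n F. i \<le> k \<and> k < j"
  using assms
proof (induction j rule: dec_induct)
  case (step j)
  show ?case
  proof (cases "grid a l n j \<in> F \<longleftrightarrow> grid a l n (Suc j) \<in> F")
    case True
    then show ?thesis using step by force
  next
    case False
    then have "j \<in> transitions a l n F" using step by (auto simp: transitions_def)
    then show ?thesis using step by auto
  qed
qed simp

text \<open>The rational witnesses near \<open>t\<close>, one inside \<open>F\<close> and one
  outside, are grid points for all large \<open>n\<close>, and a transition between them starts
  within \<open>\<epsilon> t\<close> of \<open>t\<close>. The separation condition keeps transitions
  of different points distinct; finiteness of \<open>T\<close> provides one threshold for all
  witnesses.\<close>

lemma eventually_transitions_ge:
  assumes al: "a \<in> \<rat>" "l \<in> \<rat>" "l > 0" and T: "finite T"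
    and \<epsilon>: "\<And>s t. s \<in> T \<Longrightarrow> t \<in> T \<Longrightarrow> s \<noteq> t \<Longrightarrow> \<epsilon> s + \<epsilon> t \<le> dist s (t::real)"
    and pq: "\<And>t. t \<in> T \<Longrightarrow> \<exists>p q. p \<in> \<rat> \<inter> {a..a + l} \<and> q \<in> \<rat> \<inter> {a..a + l} \<and>
      dist p t < \<epsilon> t \<and> dist q t < \<epsilon> t \<and> p \<in> F \<and> q \<notin> F"
  shows "eventually (\<lambda>n. card T \<le> card (transitions a l n F)) sequentially"
proof -
  have "\<forall>t\<in>T. \<exists>z. fst z \<in> \<rat> \<inter> {a..a + l} \<and> snd z \<in> \<rat> \<inter> {a..a + l} \<and>
      dist (fst z) t < \<epsilon> t \<and> dist (snd z) t < \<epsilon> t \<and> fst z \<in> F \<and> snd z \<notin> F"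
    using pq by simp
  then obtain z where z: "\<forall>t\<in>T. fst (z t) \<in> \<rat> \<inter> {a..a + l} \<and> snd (z t) \<in> \<rat> \<inter> {a..a + l} \<and>
      dist (fst (z t)) t < \<epsilon> t \<and> dist (snd (z t)) t < \<epsilon> t \<and> fst (z t) \<in> F \<and> snd (z t) \<notin> F"
    by (rule bchoice[THEN exE])
  define p q where "p t = fst (z t)" and "q t = snd (z t)" for t
  have p: "p t \<in> \<rat>" "p t \<in> {a..a + l}" "dist (p t) t < \<epsilon> t" "p t \<in> F"
    and q: "q t \<in> \<rat>" "q t \<in> {a..a + l}" "dist (q t) t < \<epsilon> t" "q t \<notin> F" if "t \<in> T" for t
    using bspec[OF z that] by (simp_all add: p_def q_def)
  have "eventually (\<lambda>n. \<forall>t\<in>T. (\<exists>k\<le>fact n. p t = grid a l n k) \<and> (\<exists>k\<le>fact n. q t = grid a l n k)) sequentially"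
    using p(1,2) q(1,2)
    by (intro eventually_ball_finite T ballI eventually_conj eventually_on_grid[OF al])
  then show ?thesis
  proof eventually_elim
    case (elim n)
    have "\<exists>k\<in>transitions a l n F. dist (grid a l n k) t < \<epsilon> t" if t: "t \<in> T" for t
    proof -
      obtain i j where ij: "i \<le> fact n" "p t = grid a l n i" "j \<le> fact n" "q t = grid a l n j"
        using elim t by blast
      have "\<exists>k\<in>transitions a l n F. (i \<le> k \<and> k \<le> j) \<or> (j \<le> k \<and> k \<le> i)"
      proof (cases "i \<le> j")
        case True
        then obtain k where "k \<in> transitions a l n F" "i \<le> k" "k < j"
          using transition_between[of i j n a l F] ij p(4)[OF t] q(4)[OF t] by auto
        then show ?thesis by (intro bexI[of _ k]) auto
      next
        case False
        then obtain k where "k \<in> transitions a l n F" "j \<le> k" "k < i"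
          using transition_between[of j i n a l F] ij p(4)[OF t] q(4)[OF t] by auto
        then show ?thesis by (intro bexI[of _ k]) auto
      qed
      then obtain k where k: "k \<in> transitions a l n F" "(i \<le> k \<and> k \<le> j) \<or> (j \<le> k \<and> k \<le> i)" ..
      have "p t \<le> grid a l n k \<and> grid a l n k \<le> q t \<or> q t \<le> grid a l n k \<and> grid a l n k \<le> p t"
        using k(2) al(3) unfolding ij(2,4) by (auto intro: grid_mono)
      then have "dist (grid a l n k) t < \<epsilon> t"
        using p(3)[OF t] q(3)[OF t] unfolding dist_real_def by linarith
      then show ?thesis using k(1) by (rule bexI)
    qed
    then have "\<exists>k. \<forall>t\<in>T. k t \<in> transitions a l n F \<and> dist (grid a l n (k t)) t < \<epsilon> t"
      by (intro bchoice) blast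
    then obtain k where k: "\<And>t. t \<in> T \<Longrightarrow> k t \<in> transitions a l n F \<and> dist (grid a l n (k t)) t < \<epsilon> t"
      by blast
    have "inj_on k T"
    proof (rule inj_onI, rule ccontr)
      fix s t assume st: "s \<in> T" "t \<in> T" "k s = k t" "s \<noteq> t"
      have "dist s t \<le> dist (grid a l n (k s)) s + dist (grid a l n (k t)) t"
        using dist_triangle3[of s t "grid a l n (k t)"] st(3) by simp
      then show False using k[OF st(1)] k[OF st(2)] \<epsilon>[OF st(1,2,4)] by linarith
    qed
    moreover have "k ` T \<subseteq> transitions a l n F" using k by blast
    ultimately show ?case by (intro card_inj_on_le finite_transitions)
  qed
qed

text \<open>The constructed law prescribes traces on the rationals only, so other points are
  discarded before closing.\<close>

definition rational_closure :: "real set \<Rightarrow> real set" where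
  "rational_closure F = closure (F \<inter> \<rat>)"

lemma closed_rational_closure: "closed (rational_closure F)"
  by (simp add: rational_closure_def)

lemma mem_rational_closure:
  assumes "x \<in> rational_closure F" "e > 0"
  obtains p where "p \<in> \<rat>" "p \<in> F" "dist p x < e"
  using assms closure_approachable[of x "F \<inter> \<rat>"] by (auto simp: rational_closure_def)

lemma rational_notin_near_frontier:
  assumes "x \<in> frontier (rational_closure F)" "e > 0"
  obtains q where "q \<in> \<rat>" "q \<notin> F" "dist q x < e"
proof -
  have "x \<in> closure (- rational_closure F)" using assms(1) by (simp add: frontier_closures)
  then obtain z where z: "z \<in> - rational_closure F" "dist z x < e"
    using closure_approachable assms(2) by metis
  have "open (- rational_closure F \<inter> ball x e)"
    using closed_rational_closure by (simp add: open_Compl open_Int)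
  moreover have "z \<in> - rational_closure F \<inter> ball x e" using z by (simp add: dist_commute)
  ultimately obtain d where d: "d > 0" "ball z d \<subseteq> - rational_closure F \<inter> ball x e"
    using open_contains_ball by metis
  obtain q where q: "q \<in> \<rat>" "z < q" "q < z + d" using Rats_dense_in_real[of z "z + d"] d by auto
  then have "q \<in> ball z d" by (simp add: dist_real_def)
  then have "q \<in> - rational_closure F \<inter> ball x e" using d(2) by blast
  then have "q \<notin> rational_closure F" "dist q x < e" by (auto simp: dist_commute)
  moreover have "F \<inter> \<rat> \<subseteq> rational_closure F" by (simp add: rational_closure_def closure_subset)
  ultimately show thesis using that q(1) by blast
qed

text \<open>Shift invariance is recorded for empty traces only, because avoidance probabilities
  determine the law of the closure.\<close>

locale rational_law = prob_space Q for Q :: "real set measure" +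
  fixes S2 :: "real \<Rightarrow> real" and r :: real
  assumes sets_Q: "sets Q = sets effros"
    and pair: "\<And>d d'. d \<in> \<rat> \<Longrightarrow> d' \<in> \<rat> \<Longrightarrow> prob {F. d \<in> F \<and> d' \<in> F} = S2 (d - d')"
    and avoid_shift_finite: "\<And>J d. finite J \<Longrightarrow> J \<subseteq> \<rat> \<Longrightarrow> d \<in> \<rat> \<Longrightarrow>
      prob {F. F \<inter> (+) d ` J = {}} = prob {F. F \<inter> J = {}}"
    and r_pos: "r > 0"
    and lipschitz: "\<And>x y. \<bar>S2 x - S2 y\<bar> \<le> r / 2 * \<bar>x - y\<bar>"
begin

lemma space_Q [simp]: "space Q = UNIV"
  using sets_eq_imp_space_eq[OF sets_Q] by simp

lemma pred_mem [measurable]: "Measurable.pred Q (\<lambda>F. x \<in> F)"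
  unfolding measurable_cong_sets[OF sets_Q refl] by (rule effros_mem_pred)

lemma pred_hit [measurable]: "countable J \<Longrightarrow> Measurable.pred Q (\<lambda>F. F \<inter> J \<noteq> {})"
proof -
  assume [simp]: "countable J"
  have "Measurable.pred Q (\<lambda>F. \<exists>q\<in>J. q \<in> F)" by measurable
  moreover have "(\<lambda>F. F \<inter> J \<noteq> {}) = (\<lambda>F. \<exists>q\<in>J. q \<in> F)" by (intro ext) blast
  ultimately show ?thesis by simp
qed

lemma avoid_sets: "countable J \<Longrightarrow> {F. F \<inter> J = {}} \<in> sets Q"
proof -
  assume "countable J"
  from pred_hit[OF this] have "Measurable.pred Q (\<lambda>F. \<not> (F \<inter> J \<noteq> {}))" by measurable
  then show ?thesis by (simp add: pred_def)
qed

text \<open>Each point is present with probability \<open>S2 0\<close>, so the jump has probability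
  \<open>2 * (S2 0 - S2 (d - d'))\<close>, and the \<open>2\<close> cancels the half in the
  Lipschitz constant.\<close>

lemma prob_jump_le:
  assumes "d \<in> \<rat>" "d' \<in> \<rat>"
  shows "prob {F. d \<in> F \<longleftrightarrow> d' \<notin> F} \<le> r * \<bar>d - d'\<bar>"
proof -
  let ?A = "{F. d \<in> F}" and ?B = "{F. d' \<in> F}" and ?C = "{F. d \<in> F \<and> d' \<in> F}"
  have meas: "?A \<in> sets Q" "?B \<in> sets Q" "?C \<in> sets Q"
    using pred_mem[of d] pred_mem[of d'] pred_intros_logic(3)[OF pred_mem[of d] pred_mem[of d']]
    by (simp_all add: pred_def)
  have "{F. d \<in> F \<longleftrightarrow> d' \<notin> F} = (?A - ?C) \<union> (?B - ?C)" by auto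
  then have "prob {F. d \<in> F \<longleftrightarrow> d' \<notin> F} \<le> prob (?A - ?C) + prob (?B - ?C)"
    using meas by (auto intro!: measure_Un_le)
  also have "prob (?A - ?C) = prob ?A - prob ?C"
    using meas by (intro finite_measure_Diff) auto
  also have "prob (?B - ?C) = prob ?B - prob ?C"
    using meas by (intro finite_measure_Diff) auto
  also have "prob ?A - prob ?C + (prob ?B - prob ?C) = 2 * (S2 0 - S2 (d - d'))"
    using pair[OF assms] pair[OF assms(1) assms(1)] pair[OF assms(2) assms(2)] by simp
  also have "\<dots> \<le> r * \<bar>d - d'\<bar>"
    using lipschitz[of 0 "d - d'"] abs_ge_self[of "S2 0 - S2 (d - d')"]
    by (simp add: abs_minus_commute[of d d'])
  finally show ?thesis .
qed

text \<open>The bound is the same for all \<open>n\<close>: there are \<open>fact n\<close> cells,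
  each contributing at most \<open>r * (l / fact n)\<close>.\<close>

lemma expected_transitions_le:
  assumes al: "a \<in> \<rat>" "l \<in> \<rat>" "l > 0"
  shows "(\<lambda>F. of_nat (card (transitions a l n F)) :: ennreal) \<in> borel_measurable Q"
    and "(\<integral>\<^sup>+F. of_nat (card (transitions a l n F)) \<partial>Q) \<le> ennreal (r * l)"
proof -
  define E where "E k = {F. grid a l n k \<in> F \<longleftrightarrow> grid a l n (Suc k) \<notin> F}" for k
  have E: "E k \<in> sets Q" for k
  proof -
    have "Measurable.pred Q (\<lambda>F. grid a l n k \<in> F \<longleftrightarrow> grid a l n (Suc k) \<notin> F)" by measurable
    then show ?thesis by (simp add: E_def pred_def)
  qed
  have eq: "of_nat (card (transitions a l n F)) = (\<Sum>k<fact n. indicator (E k) F :: ennreal)" for F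
    by (simp add: indicator_def sum.If_cases Int_def transitions_def E_def)
  show "(\<lambda>F. of_nat (card (transitions a l n F)) :: ennreal) \<in> borel_measurable Q"
    unfolding eq using E by measurable
  have "(\<integral>\<^sup>+F. of_nat (card (transitions a l n F)) \<partial>Q) = (\<Sum>k<fact n. emeasure Q (E k))"
    unfolding eq using E by (subst nn_integral_sum) auto
  also have "\<dots> \<le> (\<Sum>k<(fact n::nat). ennreal (r * (l / fact n)))"
  proof (intro sum_mono)
    fix k
    have "prob (E k) \<le> r * \<bar>grid a l n k - grid a l n (Suc k)\<bar>"
      unfolding E_def using al by (intro prob_jump_le grid_rat)
    also have "\<bar>grid a l n k - grid a l n (Suc k)\<bar> = l / fact n"
    proof -
      have "grid a l n (Suc k) = grid a l n k + l / fact n"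
        by (simp add: grid_def ring_distribs add_divide_distrib)
      then show ?thesis using al by simp
    qed
    finally show "emeasure Q (E k) \<le> ennreal (r * (l / fact n))"
      by (simp add: emeasure_eq_measure ennreal_leI)
  qed
  also have "\<dots> = ennreal (\<Sum>k<(fact n::nat). r * (l / fact n))"
    using al r_pos by (intro sum_ennreal) auto
  also have "(\<Sum>k<(fact n::nat). r * (l / fact n)) = r * l" by simp
  finally show "(\<integral>\<^sup>+F. of_nat (card (transitions a l n F)) \<partial>Q) \<le> ennreal (r * l)" .
qed

text \<open>Fatou's lemma, stated for arbitrary \<open>f\<close> so that the boundary count can be
  inserted directly, without a discussion of its measurability.\<close>

lemma nn_integral_liminf_transitions:
  assumes "a \<in> \<rat>" "l \<in> \<rat>" "l > 0"
    and "\<And>F. f F \<le> liminf (\<lambda>n. of_nat (card (transitions a l n F)))"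
  shows "(\<integral>\<^sup>+F. f F \<partial>Q) \<le> ennreal (r * l)"
proof -
  have "(\<integral>\<^sup>+F. f F \<partial>Q) \<le> (\<integral>\<^sup>+F. liminf (\<lambda>n. of_nat (card (transitions a l n F))) \<partial>Q)"
    using assms(4) by (intro nn_integral_mono)
  also have "\<dots> \<le> liminf (\<lambda>n. \<integral>\<^sup>+F. of_nat (card (transitions a l n F)) \<partial>Q)"
    using expected_transitions_le(1)[OF assms(1-3)] by (rule nn_integral_liminf)
  also have "\<dots> \<le> limsup (\<lambda>n. \<integral>\<^sup>+F. of_nat (card (transitions a l n F)) \<partial>Q)"
    by (rule Liminf_le_Limsup) simp
  also have "\<dots> \<le> ennreal (r * l)"
    using expected_transitions_le(2)[OF assms(1-3)] by (intro Limsup_bounded) auto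
  finally show ?thesis .
qed

lemma expected_boundary_count_le: "expected_boundary_count Q rational_closure \<le> ennreal r"
proof -
  have "emeasure (count_space UNIV) (frontier (rational_closure F) \<inter> {0<..<1})
    \<le> liminf (\<lambda>n. of_nat (card (transitions 0 1 n F)))" for F
  proof (rule emeasure_count_space_le)
    fix T assume T: "finite T" "T \<subseteq> frontier (rational_closure F) \<inter> {0<..<1}"
    have "\<exists>d>0. \<forall>s\<in>T. s \<noteq> t \<longrightarrow> d \<le> dist t s" for t
      using finite_set_avoid[OF T(1)] .
    then obtain d where d: "\<And>t. d t > 0" "\<And>s t. s \<in> T \<Longrightarrow> s \<noteq> t \<Longrightarrow> d t \<le> dist t s" by metis
    have "eventually (\<lambda>n. card T \<le> card (transitions 0 1 n F)) sequentially"
    proof (rule eventually_transitions_ge[where \<epsilon> = "\<lambda>t. d t / 2"])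
      fix s t assume st: "s \<in> T" "t \<in> T" "s \<noteq> t"
      have "d s \<le> dist s t" "d t \<le> dist s t"
        using d(2)[of s t] d(2)[of t s] st by (auto simp: dist_commute)
      then show "d s / 2 + d t / 2 \<le> dist s t" by simp
    next
      fix t assume "t \<in> T"
      then have t: "t \<in> frontier (rational_closure F)" "0 < t" "t < 1" using T by auto
      \<comment> \<open>Half the separation keeps the neighbourhoods of different boundary points
        apart; the other two bounds keep the witnesses inside the range of the grid.\<close>
      obtain e where e: "e > 0" "e \<le> d t / 2" "e \<le> t" "e \<le> 1 - t"
        using t d(1)[of t] by (intro that[of "min (d t / 2) (min t (1 - t))"]) linarith+
      have "t \<in> rational_closure F"
        using t(1) closed_rational_closure frontier_subset_closed by blast
      then obtain p where p: "p \<in> \<rat>" "p \<in> F" "dist p t < e" using e(1) by (rule mem_rational_closure)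
      obtain q where q: "q \<in> \<rat>" "q \<notin> F" "dist q t < e"
        using t(1) e(1) by (rule rational_notin_near_frontier)
      have "p \<in> {0..0 + 1}" "q \<in> {0..0 + 1}" using p q e by (auto simp: dist_real_def)
      then show "\<exists>p q. p \<in> \<rat> \<inter> {0..0 + 1} \<and> q \<in> \<rat> \<inter> {0..0 + 1} \<and>
          dist p t < d t / 2 \<and> dist q t < d t / 2 \<and> p \<in> F \<and> q \<notin> F"
        using p q e by (intro exI[of _ p] exI[of _ q]) auto
    qed (use T in auto)
    then show "of_nat (card T) \<le> liminf (\<lambda>n. of_nat (card (transitions 0 1 n F)) :: ennreal)"
      by (intro Liminf_bounded) (auto elim: eventually_mono)
  qed
  then show ?thesis
    using nn_integral_liminf_transitions[of 0 1] by (simp add: expected_boundary_count_def)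
qed

text \<open>If closing adds \<open>d\<close>, then every interval around \<open>d\<close> contains a
  rational point of \<open>F\<close> although \<open>d\<close> is not in \<open>F\<close>, so fine
  grids on it show a transition. On the interval of length \<open>2 / Suc m\<close> this has
  probability at most \<open>r * (2 / Suc m)\<close>, which tends to \<open>0\<close>.\<close>

lemma AE_mem_rational_closure_iff:
  assumes d: "d \<in> \<rat>"
  shows "AE F in Q. d \<in> rational_closure F \<longleftrightarrow> d \<in> F"
proof -
  define G where "G m = {F. d \<notin> F \<and> F \<inter> (\<rat> \<inter> {d - 1 / Suc m..d + 1 / Suc m}) \<noteq> {}}" for m
  have G: "G m \<in> sets Q" for m
  proof -
    have "countable (\<rat> \<inter> {d - 1 / Suc m..d + 1 / Suc m})"
      using countable_rat by (rule countable_subset[rotated]) auto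
    from pred_hit[OF this]
    have "Measurable.pred Q (\<lambda>F. d \<notin> F \<and> F \<inter> (\<rat> \<inter> {d - 1 / Suc m..d + 1 / Suc m}) \<noteq> {})"
      by measurable
    then show ?thesis by (simp add: G_def pred_def)
  qed
  have small: "emeasure Q (G m) \<le> ennreal (r * (2 / Suc m))" for m
  proof -
    have "indicator (G m) F \<le> liminf (\<lambda>n. of_nat (card (transitions (d - 1 / Suc m) (2 / Suc m) n F)) :: ennreal)" for F
    proof (cases "F \<in> G m")
      case True
      then obtain p where p: "p \<in> F" "p \<in> \<rat>" "p \<in> {d - 1 / Suc m..d + 1 / Suc m}" and "d \<notin> F"
        unfolding G_def by blast
      have "eventually (\<lambda>n. card {d} \<le> card (transitions (d - 1 / Suc m) (2 / Suc m) n F)) sequentially"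
      \<comment> \<open>For a single point the separation condition is vacuous, so any radius larger
        than the half-length of the interval, which is at most \<open>1\<close>, will do. The
        witness outside \<open>F\<close> is \<open>d\<close> itself.\<close>
      proof (rule eventually_transitions_ge[where \<epsilon> = "\<lambda>t. 2"])
        fix t assume "t \<in> {d}"
        have "1 / real (Suc m) \<le> 1" by simp
        then have "dist p d < 2" using p(3) unfolding dist_real_def atLeastAtMost_iff by linarith
        moreover have "d - 1 / Suc m + 2 / Suc m = d + 1 / Suc m" by simp
        ultimately show "\<exists>p q. p \<in> \<rat> \<inter> {d - 1 / Suc m..d - 1 / Suc m + 2 / Suc m} \<and>
            q \<in> \<rat> \<inter> {d - 1 / Suc m..d - 1 / Suc m + 2 / Suc m} \<and> dist p t < 2 \<and> dist q t < 2 \<and> p \<in> F \<and> q \<notin> F"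
          using p d \<open>d \<notin> F\<close> \<open>t \<in> {d}\<close> by (intro exI[of _ p] exI[of _ d]) auto
      qed (use d in auto)
      then have "(of_nat (card {d}) :: ennreal) \<le> liminf (\<lambda>n. of_nat (card (transitions (d - 1 / Suc m) (2 / Suc m) n F)))"
        by (intro Liminf_bounded) (auto elim: eventually_mono)
      then show ?thesis using True by simp
    qed simp
    then have "(\<integral>\<^sup>+F. indicator (G m) F \<partial>Q) \<le> ennreal (r * (2 / Suc m))"
      using d by (intro nn_integral_liminf_transitions[of "d - 1 / Suc m"]) simp_all
    then show ?thesis using G by simp
  qed
  have "(\<lambda>m. r * (2 / Suc m)) \<longlonglongrightarrow> r * 0"
    by (intro tendsto_mult_left LIMSEQ_Suc[of "\<lambda>n. 2 / real n"] lim_const_over_n)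
  then have lim: "(\<lambda>m. r * (2 / Suc m)) \<longlonglongrightarrow> 0" by simp
  have "prob (\<Inter>m. G m) \<le> r * (2 / Suc m)" for m
  proof -
    have "prob (\<Inter>m. G m) \<le> prob (G m)" using G by (intro finite_measure_mono) auto
    also have "\<dots> \<le> r * (2 / Suc m)"
      using small[of m] r_pos by (simp add: emeasure_eq_measure del: of_nat_Suc)
    finally show ?thesis .
  qed
  then have "prob (\<Inter>m. G m) \<le> 0" by (intro LIMSEQ_le_const[OF lim]) auto
  then have null: "(\<Inter>m. G m) \<in> null_sets Q"
    using G by (auto simp: null_sets_def emeasure_eq_measure measure_le_0_iff)
  have "{F \<in> space Q. \<not> (d \<in> rational_closure F \<longleftrightarrow> d \<in> F)} \<subseteq> (\<Inter>m. G m)"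
  proof (rule subsetI, rule INT_I)
    fix F and m :: nat assume "F \<in> {F \<in> space Q. \<not> (d \<in> rational_closure F \<longleftrightarrow> d \<in> F)}"
    moreover have "d \<in> rational_closure F" if "d \<in> F"
      using that d closure_subset[of "F \<inter> \<rat>"] by (auto simp: rational_closure_def)
    ultimately have F: "d \<in> rational_closure F" "d \<notin> F" by auto
    obtain p where "p \<in> \<rat>" "p \<in> F" "dist p d < 1 / Suc m"
      using F(1) by (rule mem_rational_closure[of _ _ "1 / Suc m"]) auto
    then have "p \<in> F \<inter> (\<rat> \<inter> {d - 1 / Suc m..d + 1 / Suc m})" by (auto simp: dist_real_def)
    then show "F \<in> G m" using F(2) by (auto simp: G_def)
  qed
  then show ?thesis by (rule AE_I'[OF null])
qed

section \<open>Avoidance probabilities and stationarity of the closure\<close>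

definition avoid :: "real set \<Rightarrow> real" where
  "avoid V = prob {F. F \<inter> (\<rat> \<inter> V) = {}}"

lemma countable_rat_Int: "countable (\<rat> \<inter> V :: real set)"
  using countable_rat by (rule countable_subset[rotated]) auto

lemma avoid_mono: "V \<subseteq> W \<Longrightarrow> avoid W \<le> avoid V"
  unfolding avoid_def using avoid_sets[OF countable_rat_Int] by (intro finite_measure_mono) auto

lemma avoid_limit:
  assumes J: "\<And>n. finite (J n)" "incseq J" "(\<Union>n. J n) = \<rat> \<inter> V"
  shows "(\<lambda>n. prob {F. F \<inter> J n = {}}) \<longlonglongrightarrow> avoid V"
proof -
  have "decseq (\<lambda>n. {F. F \<inter> J n = {}})"
    unfolding decseq_def
  proof (intro allI impI Collect_mono)
    fix m n :: nat and F assume "m \<le> n"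
    then have "J m \<subseteq> J n" using J(2) by (simp add: incseq_def)
    then show "F \<inter> J m = {}" if "F \<inter> J n = {}" using that by blast
  qed
  moreover have "range (\<lambda>n. {F. F \<inter> J n = {}}) \<subseteq> sets Q"
    using avoid_sets J(1) by (intro image_subsetI) (simp add: countable_finite)
  ultimately have "(\<lambda>n. prob {F. F \<inter> J n = {}}) \<longlonglongrightarrow> prob (\<Inter>n. {F. F \<inter> J n = {}})"
    by (intro finite_Lim_measure_decseq)
  moreover have "(\<Inter>n. {F. F \<inter> J n = {}}) = {F. F \<inter> (\<rat> \<inter> V) = {}}"
    unfolding J(3)[symmetric] by auto
  ultimately show ?thesis by (simp add: avoid_def)
qed

text \<open>Exhaust the rational points of \<open>V\<close> by finite sets and use continuity from
  above. A rational shift maps the exhaustion to one for the shifted set.\<close>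

lemma avoid_shift:
  assumes d: "d \<in> \<rat>"
  shows "avoid ((+) d ` V) = avoid V"
proof -
  obtain e :: "nat \<Rightarrow> real" where e: "range e = \<rat>"
    using countable_rat by (metis Rats_0 empty_iff range_from_nat_into)
  define J where "J n = e ` {..<n} \<inter> V" for n
  have UJ: "(\<Union>n. J n) = \<rat> \<inter> V"
    unfolding J_def e[symmetric] by (auto intro: lessI)
  have incJ: "incseq J" by (force simp: J_def incseq_def)
  have finJ: "finite (J n)" for n by (simp add: J_def)
  have ratJ: "J n \<subseteq> \<rat>" for n using UJ by blast
  have "\<rat> \<inter> (+) d ` V = (+) d ` (\<rat> \<inter> V)"
  proof (intro equalityI subsetI)
    fix x assume "x \<in> \<rat> \<inter> (+) d ` V"
    then obtain v where "x = d + v" "v \<in> V" "x \<in> \<rat>" by auto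
    moreover from this d have "v \<in> \<rat>" using Rats_diff[of x d] by simp
    ultimately show "x \<in> (+) d ` (\<rat> \<inter> V)" by blast
  qed (use d in auto)
  then have "(\<Union>n. (+) d ` J n) = \<rat> \<inter> (+) d ` V" by (simp add: UJ flip: image_UN)
  moreover have "incseq (\<lambda>n. (+) d ` J n)" using incJ by (auto simp: incseq_def)
  ultimately have "(\<lambda>n. prob {F. F \<inter> (+) d ` J n = {}}) \<longlonglongrightarrow> avoid ((+) d ` V)"
    using finJ by (intro avoid_limit) auto
  moreover have "(\<lambda>n. prob {F. F \<inter> (+) d ` J n = {}}) \<longlonglongrightarrow> avoid V"
    using avoid_limit[OF finJ incJ UJ] avoid_shift_finite[OF finJ ratJ d] by simp
  ultimately show ?thesis by (rule LIMSEQ_unique)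
qed

definition thicken :: "real set \<Rightarrow> nat \<Rightarrow> real set" where
  "thicken K n = {x. \<exists>k\<in>K. \<bar>x - k\<bar> < 1 / Suc n}"

lemma thicken_antimono:
  assumes "m \<le> n"
  shows "thicken K n \<subseteq> thicken K m"
proof -
  have "1 / real (Suc n) \<le> 1 / real (Suc m)" using assms by (simp add: frac_le)
  then show ?thesis by (force simp: thicken_def)
qed

text \<open>A closed set missing a compact set keeps a positive distance from it; conversely a point
  of the closure in \<open>K\<close> would have rational points of \<open>F\<close> arbitrarily
  near. Thus missing \<open>K\<close> reduces to countably many conditions on rational
  points.\<close>

lemma miss_eq_Union:
  assumes "compact K"
  shows "{F. rational_closure F \<inter> K = {}} = (\<Union>n. {F. F \<inter> (\<rat> \<inter> thicken K n) = {}})"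
proof (rule set_eqI, rule iffI)
  fix F assume "F \<in> {F. rational_closure F \<inter> K = {}}"
  then obtain e where e: "e > 0" "\<forall>x\<in>K. \<forall>y\<in>rational_closure F. e \<le> dist x y"
    using separate_compact_closed[OF assms closed_rational_closure, of F] by (auto simp: Int_commute)
  obtain n where n: "1 / Suc n < e" using e(1) by (metis inverse_eq_divide reals_Archimedean)
  have "F \<inter> (\<rat> \<inter> thicken K n) = {}"
  proof (rule equals0I)
    fix x assume x: "x \<in> F \<inter> (\<rat> \<inter> thicken K n)"
    then obtain k where k: "k \<in> K" "\<bar>x - k\<bar> < 1 / Suc n" by (auto simp: thicken_def)
    have "x \<in> rational_closure F"
      using x closure_subset[of "F \<inter> \<rat>"] by (auto simp: rational_closure_def)
    then have "e \<le> dist k x" using e k by blast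
    then show False using k n by (simp add: dist_real_def abs_minus_commute)
  qed
  then show "F \<in> (\<Union>n. {F. F \<inter> (\<rat> \<inter> thicken K n) = {}})" by blast
next
  fix F assume "F \<in> (\<Union>n. {F. F \<inter> (\<rat> \<inter> thicken K n) = {}})"
  then obtain n where n: "F \<inter> (\<rat> \<inter> thicken K n) = {}" by blast
  have "x \<notin> K" if x: "x \<in> rational_closure F" for x
  proof
    assume "x \<in> K"
    obtain p where "p \<in> \<rat>" "p \<in> F" "dist p x < 1 / Suc n"
      using x by (rule mem_rational_closure[of _ _ "1 / Suc n"]) auto
    then have "p \<in> F \<inter> (\<rat> \<inter> thicken K n)" using \<open>x \<in> K\<close> by (auto simp: thicken_def dist_real_def)
    then show False using n by blast
  qed
  then show "F \<in> {F. rational_closure F \<inter> K = {}}" by blast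
qed

lemma miss_sets: "compact K \<Longrightarrow> {F. rational_closure F \<inter> K = {}} \<in> sets Q"
  unfolding miss_eq_Union using avoid_sets[OF countable_rat_Int] by (intro sets.countable_UN) auto

lemma prob_miss_limit:
  assumes "compact K"
  shows "(\<lambda>n. avoid (thicken K n)) \<longlonglongrightarrow> prob {F. rational_closure F \<inter> K = {}}"
  unfolding avoid_def miss_eq_Union[OF assms]
proof (rule finite_Lim_measure_incseq)
  show "range (\<lambda>n. {F. F \<inter> (\<rat> \<inter> thicken K n) = {}}) \<subseteq> sets Q"
    using avoid_sets[OF countable_rat_Int] by (intro image_subsetI)
  show "incseq (\<lambda>n. {F. F \<inter> (\<rat> \<inter> thicken K n) = {}})"
    unfolding incseq_def
  proof (intro allI impI Collect_mono)
    fix m n :: nat and F assume "m \<le> n" "F \<inter> (\<rat> \<inter> thicken K m) = {}"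
    then show "F \<inter> (\<rat> \<inter> thicken K n) = {}" using thicken_antimono[of m n K] by blast
  qed
qed

text \<open>Invariance is known for rational shifts only. An arbitrary \<open>y\<close> is replaced
  by a nearby rational \<open>d\<close>, and the error is absorbed by enlarging the neighbourhood of
  \<open>K\<close>.\<close>

lemma prob_miss_shift_le:
  assumes K: "compact K"
  shows "prob {F. rational_closure F \<inter> K = {}} \<le> prob {F. rational_closure F \<inter> (+) y ` K = {}}"
proof (rule LIMSEQ_le_const2[OF prob_miss_limit[OF K]], intro exI[of _ 0] allI impI)
  fix n :: nat
  \<comment> \<open>This gives \<open>Suc m = 2 * Suc n\<close>: half of the radius
    \<open>1 / Suc n\<close> serves the thickening of the translate, half the replacement of
    \<open>y\<close> by \<open>d\<close>.\<close>
  define m where "m = 2 * n + 1"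
  have m: "1 / real (Suc m) + 1 / real (Suc m) = 1 / real (Suc n)"
    by (simp add: m_def field_simps)
  have yK: "compact ((+) y ` K)" using K by (rule compact_translation)
  obtain d where d: "d \<in> \<rat>" "y < d" "d < y + 1 / Suc m"
    using Rats_dense_in_real[of y "y + 1 / Suc m"] by auto
  have "thicken ((+) y ` K) m \<subseteq> (+) d ` thicken K n"
  proof
    fix x assume "x \<in> thicken ((+) y ` K) m"
    then obtain k where k: "k \<in> K" "\<bar>x - (y + k)\<bar> < 1 / Suc m" by (auto simp: thicken_def)
    have "\<bar>(x - d) - k\<bar> < 1 / Suc n" using k(2) d m by linarith
    then have "x - d \<in> thicken K n" using k(1) by (auto simp: thicken_def)
    then show "x \<in> (+) d ` thicken K n" by (rule rev_image_eqI) simp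
  qed
  then have "avoid (thicken K n) \<le> avoid (thicken ((+) y ` K) m)"
    using avoid_mono avoid_shift[OF d(1)] by metis
  also have "\<dots> \<le> prob {F. rational_closure F \<inter> (+) y ` K = {}}"
    unfolding avoid_def using miss_eq_Union[OF yK] miss_sets[OF yK] by (intro finite_measure_mono) auto
  finally show "avoid (thicken K n) \<le> prob {F. rational_closure F \<inter> (+) y ` K = {}}" .
qed

lemma prob_miss_shift:
  assumes K: "compact K"
  shows "prob {F. rational_closure F \<inter> (+) y ` K = {}} = prob {F. rational_closure F \<inter> K = {}}"
proof (rule antisym)
  have "(+) (- y) ` (+) y ` K = K" by (simp add: image_image)
  then show "prob {F. rational_closure F \<inter> (+) y ` K = {}} \<le> prob {F. rational_closure F \<inter> K = {}}"
    using prob_miss_shift_le[OF compact_translation[OF K, of y], of "- y"] by simp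
qed (rule prob_miss_shift_le[OF K])

lemma racs: "racs Q rational_closure"
  unfolding racs_def
proof (intro conjI allI impI)
  fix K :: "real set" assume "compact K"
  from sets.compl_sets[OF miss_sets[OF this]]
  have "UNIV - {F. rational_closure F \<inter> K = {}} \<in> sets Q" by simp
  moreover have "UNIV - {F. rational_closure F \<inter> K = {}} = {F \<in> space Q. rational_closure F \<inter> K \<noteq> {}}" by auto
  ultimately show "{F \<in> space Q. rational_closure F \<inter> K \<noteq> {}} \<in> sets Q" by simp
qed (simp add: closed_rational_closure)

lemma translate_miss: "(\<lambda>x. y + x) ` F \<inter> K = {} \<longleftrightarrow> F \<inter> (+) (- y) ` K = {}" for F K :: "real set"
proof -
  have "(\<lambda>x. y + x) ` F \<inter> K \<noteq> {} \<longleftrightarrow> F \<inter> (+) (- y) ` K \<noteq> {}" by (force simp: image_iff)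
  then show ?thesis by simp
qed

lemma measurable_translate: "(\<lambda>F. (\<lambda>x. y + x) ` rational_closure F) \<in> measurable Q effros"
proof (rule effros_measurableI)
  fix K :: "real set" assume "compact K"
  then have "compact ((+) (- y) ` K)" by (rule compact_translation)
  then have "{F \<in> space Q. rational_closure F \<inter> (+) (- y) ` K \<noteq> {}} \<in> sets Q"
    using racs by (simp add: racs_def)
  then show "{F \<in> space Q. (\<lambda>x. y + x) ` rational_closure F \<inter> K \<noteq> {}} \<in> sets Q"
    by (simp only: translate_miss)
qed

lemma measurable_rational_closure: "rational_closure \<in> measurable Q effros"
  using measurable_translate[of 0] by simp

lemma stationary: "stationary_racs Q rational_closure"
  unfolding stationary_racs_def
proof (intro conjI allI racs)
  fix y
  note meas = measurable_translate[of y] measurable_rational_closure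
  show "distr Q effros (\<lambda>F. (\<lambda>x. y + x) ` rational_closure F) = distr Q effros rational_closure"
  proof (rule effros_measure_eqI)
    fix K :: "real set" assume K: "compact K"
    have "space effros - {F. F \<inter> K \<noteq> {}} \<in> sets effros"
      using effros_hit_sets[OF K] by (rule sets.compl_sets)
    moreover have "space effros - {F. F \<inter> K \<noteq> {}} = {F. F \<inter> K = {}}" by auto
    ultimately have miss: "{F. F \<inter> K = {}} \<in> sets effros" by simp
    have "measure (distr Q effros (\<lambda>F. (\<lambda>x. y + x) ` rational_closure F)) {F. F \<inter> K = {}}
      = prob {F. rational_closure F \<inter> (+) (- y) ` K = {}}"
      using meas(1) miss by (simp add: measure_distr vimage_def translate_miss)
    also have "\<dots> = prob {F. rational_closure F \<inter> K = {}}"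
      using K by (rule prob_miss_shift)
    also have "\<dots> = measure (distr Q effros rational_closure) {F. F \<inter> K = {}}"
      using meas(2) miss by (simp add: measure_distr vimage_def)
    finally show "measure (distr Q effros (\<lambda>F. (\<lambda>x. y + x) ` rational_closure F)) {F. F \<inter> K = {}}
      = measure (distr Q effros rational_closure) {F. F \<inter> K = {}}" .
  qed (use meas in \<open>auto intro: finite_measure_distr\<close>)
qed

text \<open>At rational arguments closing changes nothing almost surely, so the values are those of
  the law. Both sides are Lipschitz, the left one by the necessity argument applied to the
  constructed set, whose boundary bound is already available; hence density of the rationals
  suffices.\<close>

lemma covariogram: "specific_covariogram Q rational_closure = S2"
proof
  fix y
  interpret Z: stationary_random_closed_set Q rational_closure
    by unfold_locales (rule stationary)
  have rat: "Z.two_point d = S2 d" if d: "d \<in> \<rat>" for d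
  proof -
    have AE: "AE F in Q. (0 \<in> rational_closure F \<and> - d \<in> rational_closure F) \<longleftrightarrow> (0 \<in> F \<and> - d \<in> F)"
      using AE_mem_rational_closure_iff[of 0] AE_mem_rational_closure_iff[of "- d"] d by auto
    have [measurable]: "Measurable.pred Q (\<lambda>F. x \<in> rational_closure F)" for x
      using measurable_compose[OF measurable_rational_closure effros_mem_pred] .
    have "{F \<in> space Q. 0 \<in> rational_closure F \<and> - d \<in> rational_closure F} \<in> sets Q"
      "{F \<in> space Q. 0 \<in> F \<and> - d \<in> F} \<in> sets Q" by measurable
    then have "Z.two_point d = prob {F \<in> space Q. 0 \<in> F \<and> - d \<in> F}"
      unfolding Z.two_point_def using AE by (intro finite_measure_eq_AE) auto
    then show ?thesis using pair[of 0 "- d"] d by simp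
  qed
  have lip: "\<bar>Z.two_point x - Z.two_point x'\<bar> \<le> r / 2 * \<bar>x - x'\<bar>" for x x'
    using lipschitz_onD[OF Z.covariogram_lipschitz[OF expected_boundary_count_le r_pos], of x x']
    by (simp add: Z.specific_covariogram_eq dist_real_def)
  have "Z.two_point y = S2 y"
  proof (rule ccontr)
    assume neq: "Z.two_point y \<noteq> S2 y"
    \<comment> \<open>The two Lipschitz constants add up to \<open>r\<close>, so within distance
      \<open>e\<close> the gap cannot close.\<close>
    define e where "e = \<bar>Z.two_point y - S2 y\<bar> / r"
    have "e > 0" using neq r_pos by (simp add: e_def)
    then obtain q where q: "q \<in> \<rat>" "y < q" "q < y + e" using Rats_dense_in_real[of y "y + e"] by auto
    have "\<bar>Z.two_point y - S2 y\<bar> \<le> \<bar>Z.two_point y - Z.two_point q\<bar> + \<bar>S2 q - S2 y\<bar>"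
      using rat[OF q(1)] by linarith
    also have "\<dots> \<le> r / 2 * \<bar>y - q\<bar> + r / 2 * \<bar>q - y\<bar>"
      by (intro add_mono lip lipschitz)
    also have "\<dots> = r * (q - y)" using q by simp
    also have "\<dots> < r * e" using q r_pos by simp
    also have "\<dots> = \<bar>Z.two_point y - S2 y\<bar>" using r_pos by (simp add: e_def)
    finally show False by simp
  qed
  then show "specific_covariogram Q rational_closure y = S2 y" by (simp add: Z.specific_covariogram_eq)
qed

text \<open>The theorem speaks of complete spaces. Completion leaves laws and integrals of maps
  measurable for \<open>Q\<close> unchanged, so the realization carries over.\<close>

lemma completion_realizes:
  shows "prob_space (completion Q)" "complete_measure (completion Q)"
    and "stationary_racs (completion Q) rational_closure"
    and "specific_covariogram (completion Q) rational_closure = S2"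
    and "expected_boundary_count (completion Q) rational_closure \<le> ennreal r"
proof -
  show "prob_space (completion Q)" by (rule prob_space_completion)
  show "complete_measure (completion Q)" by (rule completion.complete_measure_axioms)
  have "racs (completion Q) rational_closure"
    using racs by (auto simp: racs_def)
  then show "stationary_racs (completion Q) rational_closure"
    using stationary measurable_translate measurable_rational_closure
    by (simp add: stationary_racs_def distr_completion)
  show "expected_boundary_count (completion Q) rational_closure \<le> ennreal r"
    using expected_boundary_count_le by (simp add: expected_boundary_count_def nn_integral_completion)
  interpret Z: stationary_random_closed_set Q rational_closure
    by unfold_locales (rule stationary)
  have "(\<lambda>F. delta_yW y {0<..<1} (rational_closure F)) \<in> borel_measurable Q" for y
    using Z.delta_expectation(1)[OF interval_windows] by (rule borel_measurable_integrable)
  then have "specific_covariogram (completion Q) rational_closure = specific_covariogram Q rational_closure"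
    by (simp add: fun_eq_iff specific_covariogram_def delta_yW_def integral_completion)
  then show "specific_covariogram (completion Q) rational_closure = S2" by (simp add: covariogram)
qed

end

section \<open>Assembly of the two directions\<close>

lemma rational_law_exists:
  assumes adm: "F_spec_cov_admissible S2" and lip: "L-lipschitz_on UNIV S2" "L \<le> r / 2" and "r > 0"
  obtains Q where "rational_law Q S2 r"
proof -
  show thesis
  proof (rule limit_law[OF adm])
    fix p :: "real set \<Rightarrow> real set \<Rightarrow> real"
    assume nonneg: "\<And>J A. finite J \<Longrightarrow> J \<subseteq> \<rat> \<Longrightarrow> A \<subseteq> J \<Longrightarrow> p J A \<ge> 0"
      and one: "p {} {} = 1"
      and marginal: "\<And>H J A. finite H \<Longrightarrow> H \<subseteq> \<rat> \<Longrightarrow> J \<subseteq> H \<Longrightarrow> A \<subseteq> J \<Longrightarrow>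
        p J A = (\<Sum>B | B \<subseteq> H \<and> B \<inter> J = A. p H B)"
      and shift: "\<And>J A d. finite J \<Longrightarrow> J \<subseteq> \<rat> \<Longrightarrow> A \<subseteq> J \<Longrightarrow> d \<in> \<rat> \<Longrightarrow>
        p ((+) d ` J) ((+) d ` A) = p J A"
      and two: "\<And>d d'. d \<in> \<rat> \<Longrightarrow> d' \<in> \<rat> \<Longrightarrow> p {d, d'} {d, d'} = S2 (d - d')"
    show thesis
    proof (rule effros_law_exists[where I = \<rat> and p = p])
      fix Q assume Q: "prob_space Q" "sets Q = sets effros"
        and law: "\<And>J A. finite J \<Longrightarrow> J \<subseteq> \<rat> \<Longrightarrow> A \<subseteq> J \<Longrightarrow> measure Q {F. F \<inter> J = A} = p J A"
      show thesis
      proof (rule that[of Q], intro rational_law.intro rational_law_axioms.intro Q)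
        fix d d' :: real assume d: "d \<in> \<rat>" "d' \<in> \<rat>"
        have "{F. d \<in> F \<and> d' \<in> F} = {F. F \<inter> {d, d'} = {d, d'}}" by auto
        then show "measure Q {F. d \<in> F \<and> d' \<in> F} = S2 (d - d')"
          using law[of "{d, d'}" "{d, d'}"] two[OF d] d by simp
      next
        fix J :: "real set" and d :: real assume J: "finite J" "J \<subseteq> \<rat>" "d \<in> \<rat>"
        then have "(+) d ` J \<subseteq> \<rat>" by auto
        then show "measure Q {F. F \<inter> (+) d ` J = {}} = measure Q {F. F \<inter> J = {}}"
          using law[of "(+) d ` J" "{}"] law[of J "{}"] shift[of J "{}" d] J by simp
      next
        fix x y
        have "\<bar>S2 x - S2 y\<bar> \<le> L * \<bar>x - y\<bar>"
          using lipschitz_onD[OF lip(1), of x y] by (simp add: dist_real_def)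
        also have "\<dots> \<le> r / 2 * \<bar>x - y\<bar>" using lip(2) by (intro mult_right_mono) auto
        finally show "\<bar>S2 x - S2 y\<bar> \<le> r / 2 * \<bar>x - y\<bar>" .
      qed fact
    qed (fact countable_rat nonneg one marginal)+
  qed
qed

lemma necessity:
  assumes "r > 0" "prob_space M" "stationary_racs M Z" "expected_boundary_count M Z \<le> ennreal r"
  shows "F_spec_cov_admissible (specific_covariogram M Z)"
    and "(r / 2)-lipschitz_on UNIV (specific_covariogram M Z)"
proof -
  interpret stationary_random_closed_set M Z
    using assms by (simp add: stationary_random_closed_set_def stationary_random_closed_set_axioms_def)
  show "F_spec_cov_admissible (specific_covariogram M Z)" by (rule admissible)
  show "(r / 2)-lipschitz_on UNIV (specific_covariogram M Z)"
    using assms by (intro covariogram_lipschitz)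
qed

lemma sufficiency:
  assumes "r > 0" "F_spec_cov_admissible S2" "L \<le> r / 2" "L-lipschitz_on UNIV S2"
  obtains M :: "real set measure" and Z :: "real set \<Rightarrow> real set"
  where "prob_space M" "complete_measure M" "stationary_racs M Z"
    "S2 = specific_covariogram M Z" "expected_boundary_count M Z \<le> ennreal r"
proof -
  obtain Q where Q: "rational_law Q S2 r"
    using rational_law_exists assms by metis
  show thesis
    using that rational_law.completion_realizes[OF Q] by metis
qed

text \<open>A prescribed probability space may be too small to carry the required random set, so the
  converse chooses the space together with \<open>Z\<close>, on the type \<open>real set\<close>
  where the law is built. The forward implication is stated in addition for spaces over any type.
  The Lipschitz witness is \<open>r / 2\<close> itself.\<close>

theorem theorem4p12:
  fixes S2 :: "real \<Rightarrow> real" and r :: real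
  assumes "r > 0"
  shows "(\<forall>(M::'w measure) (Z::'w \<Rightarrow> real set).
            prob_space M \<and> complete_measure M \<and> stationary_racs M Z \<and>
            S2 = specific_covariogram M Z \<and> expected_boundary_count M Z \<le> ennreal r
            \<longrightarrow> F_spec_cov_admissible S2 \<and> (\<exists>L. L \<le> r / 2 \<and> L-lipschitz_on UNIV S2))
       \<and> ((\<exists>(M::real set measure) (Z::real set \<Rightarrow> real set).
            prob_space M \<and> complete_measure M \<and> stationary_racs M Z \<and>
            S2 = specific_covariogram M Z \<and> expected_boundary_count M Z \<le> ennreal r)
          \<longleftrightarrow> F_spec_cov_admissible S2 \<and> (\<exists>L. L \<le> r / 2 \<and> L-lipschitz_on UNIV S2))"
proof (intro conjI iffI allI impI)
  fix M :: "'w measure" and Z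
  assume H: "prob_space M \<and> complete_measure M \<and> stationary_racs M Z \<and>
    S2 = specific_covariogram M Z \<and> expected_boundary_count M Z \<le> ennreal r"
  then show "F_spec_cov_admissible S2" using necessity(1)[OF assms, of M Z] by simp
  show "\<exists>L. L \<le> r / 2 \<and> L-lipschitz_on UNIV S2"
    using H necessity(2)[OF assms, of M Z] by (intro exI[of _ "r / 2"]) simp
next
  assume "\<exists>(M::real set measure) (Z::real set \<Rightarrow> real set).
    prob_space M \<and> complete_measure M \<and> stationary_racs M Z \<and>
    S2 = specific_covariogram M Z \<and> expected_boundary_count M Z \<le> ennreal r"
  then obtain M :: "real set measure" and Z :: "real set \<Rightarrow> real set"
    where H: "prob_space M" "stationary_racs M Z" "S2 = specific_covariogram M Z"
      "expected_boundary_count M Z \<le> ennreal r" by (elim exE conjE)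
  show "F_spec_cov_admissible S2" using H necessity(1)[OF assms, of M Z] by simp
  show "\<exists>L. L \<le> r / 2 \<and> L-lipschitz_on UNIV S2"
    using H necessity(2)[OF assms, of M Z] by (intro exI[of _ "r / 2"]) simp
next
  assume "F_spec_cov_admissible S2 \<and> (\<exists>L. L \<le> r / 2 \<and> L-lipschitz_on UNIV S2)"
  then obtain L where L: "F_spec_cov_admissible S2" "L \<le> r / 2" "L-lipschitz_on UNIV S2"
    by (elim exE conjE)
  obtain M :: "real set measure" and Z :: "real set \<Rightarrow> real set"
    where "prob_space M" "complete_measure M" "stationary_racs M Z"
      "S2 = specific_covariogram M Z" "expected_boundary_count M Z \<le> ennreal r"
    using sufficiency[OF assms L] .
  then show "\<exists>(M::real set measure) (Z::real set \<Rightarrow> real set).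
    prob_space M \<and> complete_measure M \<and> stationary_racs M Z \<and>
    S2 = specific_covariogram M Z \<and> expected_boundary_count M Z \<le> ennreal r"
    by (intro exI conjI)
qed

end
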